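(* Assume hypotheses H1, H2 and H3 (stated in the context). Then for $0<\varepsilon<\lambda$ small enough (i.e. there is $\lambda_0>0$ such that for all $0<\varepsilon<\lambda\le\lambda_0$) and for all $(i,j)\in E\times E$, $$\sum_{n=0}^{+\infty}\mathbb{E}_i\big[e^{\lambda m_n-\varepsilon S_n},\,X_n=j\big]<+\infty .$$
   Context: Setup. $E$ is a finite set with $N$ elements, $(X_n)_{n\ge0}$ is an irreducible and aperiodic Markov chain on $E$ with transition matrix $P=(p_{i,j})_{i,j\in E}$ and unique invariant probability $\nu=(\nu_i)_{i\in E}$. $(F(i,j,dt))_{i,j\in E}$ is a family of probability measures on $\mathbb{R}$. $(Y_n,X_n)_{n\ge0}$ is a Markov chain on $\mathbb{R}\times E$ with transition probability $$\mathbb{P}(Y_{n+1}\in A,\,X_{n+1}=j\mid Y_n=u,\,X_n=i)=p_{i,j}\,F(i,j,A)$$ for $(u,i)\in\mathbb{R}\times E$, $A\subset\mathbb{R}$ Borel, $j\in E$. $\mathbb{P}_i$ and $\mathbb{E}_i$ denote probability and expectation for this chain started from $(Y_0,X_0)=(0,i)$, and $\mathbb{E}_i[Z,X_n=j]$ means $\mathbb{E}_i[Z\mathbf{1}_{\{X_n=j\}}]$. Set $S_0=0$, $S_n=Y_1+\cdots+Y_n$, and $m_n=\min(S_0,S_1,\dots,S_n)$. Hypotheses. H1: there exists $\alpha>0$ such that for all $\lambda\in\mathbb{C}$ with $|\mathrm{Re}\,\lambda|\le\alpha$, $\sup_{(i,j)\in E\times E}|\widehat F(i,j,\lambda)|<+\infty$,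 where $\widehat F(i,j,\lambda)=\int_{\mathbb{R}}e^{\lambda t}F(i,j,dt)$. H2: there exist $n_0\ge1$ and $(i_0,j_0)\in E\times E$ such that the measure $\mathbb{P}_{i_0}(X_{n_0}=j_0,\,S_{n_0}\in dx)$ has a (non-zero) absolutely continuous component with respect to Lebesgue measure on $\mathbb{R}$. H3: $\sum_{(i,j)\in E\times E}\nu_i p_{i,j}\int_{\mathbb{R}}t\,F(i,j,dt)=0$. *)

theory Defs
  imports "HOL-Probability.Probability"
begin

definition mat_pow :: "real^'e^'e \<Rightarrow> nat \<Rightarrow> real^'e^('e::finite)" where
  "mat_pow P n = (((**) P) ^^ n) (mat 1)"

definition transition_matrix :: "real^'e^('e::finite) \<Rightarrow> bool" where
  "transition_matrix P \<longleftrightarrow> (\<forall>i j. 0 \<le> P $ i $ j) \<and> (\<forall>i. (\<Sum>j\<in>UNIV. P $ i $ j) = 1)"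

definition irreducible_matrix :: "real^'e^('e::finite) \<Rightarrow> bool" where
  "irreducible_matrix P \<longleftrightarrow> (\<forall>i j. \<exists>n. 0 < mat_pow P n $ i $ j)"

definition aperiodic_matrix :: "real^'e^('e::finite) \<Rightarrow> bool" where
  "aperiodic_matrix P \<longleftrightarrow> (\<forall>i. Gcd {n. 1 \<le> n \<and> 0 < mat_pow P n $ i $ i} = 1)"

definition invariant_probability :: "real^'e^('e::finite) \<Rightarrow> real^'e \<Rightarrow> bool" where
  "invariant_probability P \<nu> \<longleftrightarrow>
     (\<forall>i. 0 \<le> \<nu> $ i) \<and> (\<Sum>i\<in>UNIV. \<nu> $ i) = 1 \<and> \<nu> v* P = \<nu>"

definition natural_filtration ::
  "'w measure \<Rightarrow> 's measure \<Rightarrow> (nat \<Rightarrow> 'w \<Rightarrow> 's) \<Rightarrow> nat \<Rightarrow> 'w measure" where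
  "natural_filtration M S Z n =
     sigma (space M) (\<Union>k\<in>{..n}. {Z k -` A \<inter> space M | A. A \<in> sets S})"

text \<open>Under the probability measure \<open>M\<close> the process \<open>(Y n, X n)\<close> is a Markov chain on
  \<open>\<real> \<times> 'e\<close> started from \<open>(0, i)\<close>. The last assumption is the transition law, with the
  conditioning taken on the whole past up to time \<open>n\<close>, so that it includes the Markov property.
  Rectangles \<open>A \<times> {j}\<close> suffice to determine the transition kernel.\<close>

locale markov_additive_chain = prob_space M
  for M :: "'w measure"
    and P :: "real^'e^('e::finite)"
    and F :: "'e \<Rightarrow> 'e \<Rightarrow> real measure"
    and Y :: "nat \<Rightarrow> 'w \<Rightarrow> real"
    and X :: "nat \<Rightarrow> 'w \<Rightarrow> 'e"
    and i :: 'e +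
  assumes Y_measurable: "\<And>n. Y n \<in> borel_measurable M"
    and X_measurable: "\<And>n. X n \<in> measurable M (count_space UNIV)"
    and start: "AE w in M. Y 0 w = 0 \<and> X 0 w = i"
    and transition: "\<And>n A j. A \<in> sets borel \<Longrightarrow>
      AE w in M.
        real_cond_exp M
          (natural_filtration M (borel \<Otimes>\<^sub>M count_space UNIV) (\<lambda>k w. (Y k w, X k w)) n)
          (indicator {w \<in> space M. Y (Suc n) w \<in> A \<and> X (Suc n) w = j}) w
        = P $ X n w $ j * measure (F (X n w) j) A"

definition partial_sum :: "(nat \<Rightarrow> 'w \<Rightarrow> real) \<Rightarrow> nat \<Rightarrow> 'w \<Rightarrow> real" where
  "partial_sum Y n w = (\<Sum>k=1..n. Y k w)"

definition running_min :: "(nat \<Rightarrow> 'w \<Rightarrow> real) \<Rightarrow> nat \<Rightarrow> 'w \<Rightarrow> real" where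
  "running_min Y n w = Min ((\<lambda>k. partial_sum Y k w) ` {..n})"

definition Laplace_transform :: "real measure \<Rightarrow> complex \<Rightarrow> complex" where
  "Laplace_transform \<mu> l = (\<integral>t. exp (l * complex_of_real t) \<partial>\<mu>)"

text \<open>The Bochner integral of a non-integrable function is \<open>0\<close>, so the existence of the
  transforms has to be required separately.\<close>

definition hyp_H1 :: "('e::finite \<Rightarrow> 'e \<Rightarrow> real measure) \<Rightarrow> bool" where
  "hyp_H1 F \<longleftrightarrow> (\<exists>\<alpha>>0. \<forall>l::complex. \<bar>Re l\<bar> \<le> \<alpha> \<longrightarrow>
     (\<forall>i j. integrable (F i j) (\<lambda>t. exp (l * complex_of_real t))) \<and>
     bdd_above (range (\<lambda>(i, j). cmod (Laplace_transform (F i j) l))))"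

text \<open>A measure on the line has a non-zero absolutely continuous component if, in its Lebesgue
  decomposition \<open>\<mu> = \<mu>a + \<mu>s\<close> with \<open>\<mu>a\<close> absolutely continuous and \<open>\<mu>s\<close> carried by a Lebesgue null
  set, \<open>\<mu>a\<close> is not zero.\<close>

definition has_ac_component :: "real measure \<Rightarrow> bool" where
  "has_ac_component \<mu> \<longleftrightarrow> (\<exists>\<mu>a \<mu>s :: real measure.
     sets \<mu>a = sets borel \<and> sets \<mu>s = sets borel \<and>
     (\<forall>A\<in>sets borel. emeasure \<mu> A = emeasure \<mu>a A + emeasure \<mu>s A) \<and>
     absolutely_continuous lborel \<mu>a \<and>
     (\<exists>N\<in>null_sets lborel. emeasure \<mu>s (UNIV - N) = 0) \<and>
     emeasure \<mu>a UNIV \<noteq> 0)"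

text \<open>The sub-probability measure \<open>A \<mapsto> M (X n = j, S n \<in> A)\<close>, where \<open>S n\<close> is the partial sum.\<close>

definition sum_law_on ::
  "'w measure \<Rightarrow> (nat \<Rightarrow> 'w \<Rightarrow> real) \<Rightarrow> (nat \<Rightarrow> 'w \<Rightarrow> 'e) \<Rightarrow> nat \<Rightarrow> 'e \<Rightarrow> real measure" where
  "sum_law_on M Y X n j =
     distr (restrict_space M {w \<in> space M. X n w = j}) borel (partial_sum Y n)"

definition hyp_H2 ::
  "('e::finite \<Rightarrow> 'w measure) \<Rightarrow> (nat \<Rightarrow> 'w \<Rightarrow> real) \<Rightarrow> (nat \<Rightarrow> 'w \<Rightarrow> 'e) \<Rightarrow> bool" where
  "hyp_H2 \<PP> Y X \<longleftrightarrow> (\<exists>n0\<ge>1. \<exists>i0 j0. has_ac_component (sum_law_on (\<PP> i0) Y X n0 j0))"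

definition hyp_H3 ::
  "real^'e^('e::finite) \<Rightarrow> real^'e \<Rightarrow> ('e \<Rightarrow> 'e \<Rightarrow> real measure) \<Rightarrow> bool" where
  "hyp_H3 P \<nu> F \<longleftrightarrow>
     (\<Sum>(i, j)\<in>UNIV. \<nu> $ i * P $ i $ j * (\<integral>t. t \<partial>F i j)) = 0"

end

theory Submission
  imports Defs
begin

text \<open>Put \<open>a = \<lambda> - \<epsilon> > 0\<close> and \<open>D\<^sub>n = S\<^sub>n - m\<^sub>n \<ge> 0\<close>, so that the weight
  \<open>exp (\<lambda> m\<^sub>n - \<epsilon> S\<^sub>n)\<close> becomes \<open>exp (a m\<^sub>n - \<epsilon> D\<^sub>n)\<close>. The process \<open>D\<close> is the walk
  reflected at its minimum: a step \<open>y\<close> either moves \<open>D\<close> to \<open>D + y \<ge> 0\<close> and keeps \<open>m\<close>, or,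
  when \<open>D + y < 0\<close>, resets \<open>D\<close> to \<open>0\<close> and lowers \<open>m\<close> by \<open>-(D + y)\<close>, which multiplies
  \<open>exp (a m)\<close> by \<open>exp (a (D + y))\<close>. Hence, if \<open>g x d \<ge> 0\<close> is defined for \<open>d \<ge> 0\<close> and extended by
  \<open>g x u = exp (a u) * g x 0\<close> to \<open>u < 0\<close>, the expectation of \<open>exp (a m\<^sub>n) * g X\<^sub>n D\<^sub>n\<close> evolves by the
  kernel of the free walk. If \<open>g\<close> is a Lyapunov function, that is, if one step from
  \<open>(x, d)\<close>, \<open>d \<ge> 0\<close>, lowers the mean of \<open>g\<close> by at least \<open>c exp (- \<epsilon> d)\<close>, then telescoping bounds
  the whole series by \<open>g i 0 / c\<close> (lemma \<open>weighted_occupation_finite\<close>).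

  The Lyapunov function is \<open>g x d = A - \<phi> x exp (- \<epsilon> d)\<close> with a large constant \<open>A\<close>. On the whole line
  this would have the required drop as soon as \<open>\<phi> > 0\<close> satisfies \<open>T \<phi> > \<phi>\<close> in every coordinate,
  where \<open>T x j = p x j * \<integral> exp (- \<epsilon> t) F x j (dt)\<close>. The extension to negative arguments differs from
  that formula, but a large \<open>A\<close> makes \<open>g\<close> steep just to the left of \<open>0\<close>, so that the difference is
  unfavourable only for overshoots beyond a large level. Exponential moments of order \<open>\<alpha> > \<epsilon>\<close> make
  the cost of these overshoots a small multiple of \<open>exp (- \<epsilon> d)\<close> (lemmas \<open>overshoot_bound\<close> and
  \<open>lyapunov_function_exists\<close>).

  The vector \<open>\<phi>\<close> is where centring and spreading enter. Since the stationary drift vanishes, the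
  Poisson equation gives \<open>h\<close> for which \<open>Y\<^sub>1 + h X\<^sub>1 - h X\<^sub>0\<close> has mean zero from every state, and the
  convexity of \<open>exp\<close> gives \<open>T \<phi> \<ge> \<phi>\<close> for \<open>\<phi> = exp (- \<epsilon> h)\<close>. Equality in all coordinates would make
  all these centred steps vanish almost surely; then \<open>S\<^sub>n = h X\<^sub>0 - h X\<^sub>n\<close> would take finitely many
  values, which is incompatible with an absolutely continuous component (lemma
  \<open>increments_not_coboundary\<close>). So the inequality is strict somewhere, and irreducibility spreads the
  strictness to all states (lemma \<open>strictly_subharmonic_of_subharmonic\<close>).

  The argument works for every pair \<open>0 < \<epsilon> < \<lambda> \<le> \<alpha>\<close>, because \<open>A\<close>, \<open>\<phi>\<close> and \<open>c\<close> may depend on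
  \<open>\<epsilon>\<close> and \<open>\<lambda>\<close>.\<close>

section \<open>Irreducible nonnegative matrices and the Poisson equation\<close>

lemma mat_pow_Suc: "mat_pow P (Suc n) = P ** mat_pow P n"
  by (simp add: mat_pow_def)

lemma matrix_vector_mult_nonneg:
  fixes T :: "real^'e^('e::finite)"
  assumes "\<And>i j. 0 \<le> T $ i $ j" "\<And>i. 0 \<le> v $ i"
  shows "0 \<le> (T *v v) $ i"
  using assms by (simp add: matrix_vector_mult_def sum_nonneg)

lemma matrix_power_apply_nonneg:
  fixes T :: "real^'e^('e::finite)"
  assumes "\<And>i j. 0 \<le> T $ i $ j" "\<And>i. 0 \<le> v $ i"
  shows "0 \<le> (((*v) T ^^ n) v) $ i"
proof (induction n arbitrary: i)
  case (Suc n)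
  then show ?case using matrix_vector_mult_nonneg[OF assms(1)] by simp
qed (use assms in auto)

text \<open>Two matrices appear below, \<open>P\<close> itself and its exponentially tilted version; only the pattern of
  positive entries matters, so irreducibility of \<open>P\<close> is used for any \<open>T\<close> with at least that pattern.\<close>
lemma positive_entry_propagates:
  fixes P T :: "real^'e^('e::finite)"
  assumes P: "\<And>i j. 0 \<le> P $ i $ j"
    and T: "\<And>i j. 0 \<le> T $ i $ j" "\<And>i j. 0 < P $ i $ j \<Longrightarrow> 0 < T $ i $ j"
    and v: "\<And>i. 0 \<le> v $ i" "0 < v $ j"
    and "0 < mat_pow P n $ i $ j"
  shows "0 < (((*v) T ^^ n) v) $ i"
  using assms(6)
proof (induction n arbitrary: i)
  case 0
  then show ?case using v by (auto simp: mat_pow_def mat_def split: if_splits)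
next
  case (Suc n)
  let ?w = "((*v) T ^^ n) v"
  have w0: "0 \<le> ?w $ k" for k
    using matrix_power_apply_nonneg[OF T(1) v(1)] .
  have "0 < (\<Sum>k\<in>UNIV. P $ i $ k * mat_pow P n $ k $ j)"
    using Suc.prems by (simp add: mat_pow_Suc matrix_matrix_mult_def)
  then have "\<not> (\<forall>k. P $ i $ k * mat_pow P n $ k $ j \<le> 0)"
    using sum_nonpos[of UNIV "\<lambda>k. P $ i $ k * mat_pow P n $ k $ j"] by auto
  then obtain k where "0 < P $ i $ k * mat_pow P n $ k $ j"
    by (auto simp: not_le)
  then have k: "0 < P $ i $ k" "0 < mat_pow P n $ k $ j"
    using P[of i k] by (auto simp: zero_less_mult_iff)
  have "0 < T $ i $ k * ?w $ k"
    using T(2)[OF k(1)] Suc.IH[OF k(2)] by simp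
  then have "0 < (\<Sum>k\<in>UNIV. T $ i $ k * ?w $ k)"
    by (intro sum_pos2[of _ k]) (auto simp: T(1) w0)
  moreover have "(T *v u) $ i = (\<Sum>k\<in>UNIV. T $ i $ k * u $ k)" for u
    by (simp add: matrix_vector_mult_def)
  ultimately show ?case by simp
qed

text \<open>Maximum principle: the difference between a harmonic vector and its minimum is a nonnegative
  harmonic vector, and by irreducibility a positive coordinate would make all of its coordinates
  positive, including the one where the minimum is attained.\<close>
lemma harmonic_imp_constant:
  fixes P :: "real^'e^('e::finite)"
  assumes tm: "transition_matrix P" and irr: "irreducible_matrix P"
    and h: "P *v h = h"
  shows "h $ i = h $ j"
proof -
  have P0: "\<And>i j. 0 \<le> P $ i $ j" and P1: "\<And>i. (\<Sum>j\<in>UNIV. P $ i $ j) = 1"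
    using tm by (auto simp: transition_matrix_def)
  define k where "k = arg_min_on (\<lambda>i. h $ i) UNIV"
  have k: "h $ k \<le> h $ l" for l
    unfolding k_def by (rule arg_min_least) auto
  define v :: "real^'e" where "v = (\<chi> i. h $ i - h $ k)"
  have "P *v v = v"
    using h by (simp add: vec_eq_iff v_def matrix_vector_mult_def right_diff_distrib
        sum_subtractf sum_distrib_right[symmetric] P1)
  then have pw: "((*v) P ^^ n) v = v" for n by (induction n) auto
  have "h $ l = h $ k" for l
  proof (rule ccontr)
    assume "h $ l \<noteq> h $ k"
    then have l: "0 < v $ l" using k[of l] by (simp add: v_def)
    obtain n where n: "0 < mat_pow P n $ k $ l"
      using irr by (auto simp: irreducible_matrix_def)
    have "0 < (((*v) P ^^ n) v) $ k"
      by (rule positive_entry_propagates[OF P0 P0 _ _ l n]) (auto simp: v_def k)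
    then show False unfolding pw by (simp add: v_def)
  qed
  then show ?thesis by metis
qed

text \<open>Fredholm alternative. The rank-one correction \<open>v \<mapsto> v - P v + (\<nu> \<bullet> v) 1\<close> is injective, because
  pairing with \<open>\<nu>\<close> kills \<open>v - P v\<close> and the kernel of \<open>1 - P\<close> consists of constants. It is therefore
  onto, and it preserves the pairing with \<open>\<nu>\<close>; so if \<open>\<nu> \<bullet> m = 0\<close>, the correction vanishes at the
  preimage of \<open>m\<close>.\<close>
lemma poisson_equation_solvable:
  fixes P :: "real^'e^('e::finite)"
  assumes tm: "transition_matrix P" and irr: "irreducible_matrix P"
    and inv: "invariant_probability P \<nu>"
    and m: "\<nu> \<bullet> m = 0"
  shows "\<exists>h. h - P *v h = m"
proof -
  have \<nu>1: "(\<Sum>i\<in>UNIV. \<nu> $ i) = 1" and \<nu>P: "\<nu> v* P = \<nu>"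
    using inv by (auto simp: invariant_probability_def)
  define e :: "real^'e" where "e = (\<chi> i. 1)"
  have \<nu>e: "\<nu> \<bullet> e = 1" by (simp add: e_def inner_vec_def \<nu>1)
  have \<nu>0: "\<nu> \<bullet> (v - P *v v) = 0" for v
    by (simp add: inner_diff_right dot_lmul_matrix[symmetric] \<nu>P)
  define Q where "Q v = v - P *v v + (\<nu> \<bullet> v) *\<^sub>R e" for v
  have \<nu>Q: "\<nu> \<bullet> Q v = \<nu> \<bullet> v" for v
    by (simp add: Q_def inner_add_right \<nu>0 \<nu>e)
  have lin: "linear Q"
    unfolding Q_def
    by (intro linearI) (auto simp: algebra_simps inner_add_right
        matrix_vector_mult_scaleR)
  have "v = 0" if "Q v = 0" for v
  proof -
    have v0: "\<nu> \<bullet> v = 0" using \<nu>Q[of v] that by simp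
    then have "P *v v = v" using that by (simp add: Q_def)
    then have "v $ i = v $ j" for i j
      using harmonic_imp_constant[OF tm irr] by blast
    then obtain c where c: "\<And>i. v $ i = c" by metis
    then have "v = c *\<^sub>R e" by (simp add: vec_eq_iff e_def)
    then show ?thesis using v0 \<nu>e by simp
  qed
  then have "inj Q" using lin linear_injective_0 by blast
  then have "surj Q" using lin linear_injective_imp_surjective by blast
  then obtain h where h: "m = Q h" by (meson surjD)
  then have "\<nu> \<bullet> h = 0" using \<nu>Q[of h] m by simp
  then show ?thesis using h by (auto simp: Q_def)
qed

text \<open>The vector \<open>w = T v - v\<close> is nonnegative and positive at one state. For \<open>u = v + T v + \<dots> + T\<^sup>N v\<close>
  the defect is \<open>T u - u = w + T w + \<dots> + T\<^sup>N w\<close>, which is positive everywhere once \<open>N\<close> is at least the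
  number of steps needed to reach that state from any other.\<close>
lemma strictly_subharmonic_of_subharmonic:
  fixes P T :: "real^'e^('e::finite)"
  assumes irr: "irreducible_matrix P" and P: "\<And>i j. 0 \<le> P $ i $ j"
    and T: "\<And>i j. 0 \<le> T $ i $ j" "\<And>i j. 0 < P $ i $ j \<Longrightarrow> 0 < T $ i $ j"
    and v: "\<And>i. 0 < v $ i" "\<And>i. v $ i \<le> (T *v v) $ i"
    and k: "v $ k < (T *v v) $ k"
  shows "\<exists>u. (\<forall>i. 0 < u $ i) \<and> (\<forall>i. u $ i < (T *v u) $ i)"
proof -
  define w where "w = T *v v - v"
  have w: "0 \<le> w $ i" "0 < w $ k" for i using v k by (auto simp: w_def)
  have "\<forall>i. \<exists>n. 0 < mat_pow P n $ i $ k"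
    using irr by (simp add: irreducible_matrix_def)
  then obtain n where n: "\<And>i. 0 < mat_pow P (n i) $ i $ k"
    by metis
  define N where "N = Max (range n)"
  have N: "n i \<le> N" for i by (simp add: N_def)
  let ?I = "\<lambda>n v. ((*v) T ^^ n) v"
  define u where "u = (\<Sum>l\<le>N. ?I l v)"
  have "0 < ?I 0 v $ i" for i using v by simp
  moreover have "0 \<le> ?I l v $ i" for l i
    using matrix_power_apply_nonneg[OF T(1)] v(1) less_imp_le by metis
  ultimately have u0: "0 < u $ i" for i
    unfolding u_def sum_component by (intro sum_pos2[of _ 0]) auto
  have lin: "T *v (\<Sum>l\<in>A. f l) = (\<Sum>l\<in>A. T *v f l)" for f :: "nat \<Rightarrow> real^'e" and A
    using linear_sum[OF matrix_vector_mul_linear] by blast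
  have I: "T *v (?I l v) = ?I l v + ?I l w" for l
  proof (induction l)
    case (Suc l)
    then show ?case by (simp add: matrix_vector_right_distrib)
  qed (simp add: w_def)
  have "T *v u = u + (\<Sum>l\<le>N. ?I l w)"
    unfolding u_def lin by (simp add: I sum.distrib)
  moreover have "0 < (\<Sum>l\<le>N. ?I l w) $ i" for i
    unfolding sum_component
  proof (rule sum_pos2[of _ "n i"])
    show "0 < ?I (n i) w $ i"
      by (rule positive_entry_propagates[OF P T _ w(2) n]) (use w in auto)
    show "0 \<le> ?I l w $ i" for l
      by (rule matrix_power_apply_nonneg[OF T(1) w(1)])
  qed (use N in auto)
  ultimately show ?thesis using u0 by (intro exI[of _ u]) (simp add: sum_component)
qed

section \<open>A strictly subharmonic vector for the tilted matrix\<close>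

definition tilted_matrix ::
  "real^'e^('e::finite) \<Rightarrow> ('e \<Rightarrow> 'e \<Rightarrow> real measure) \<Rightarrow> real \<Rightarrow> real^'e^'e" where
  "tilted_matrix P F s = (\<chi> i j. P $ i $ j * (\<integral>t. exp (s * t) \<partial>F i j))"

lemma (in prob_space) exp_integral_pos:
  fixes f :: "'a \<Rightarrow> real"
  assumes "integrable M (\<lambda>t. exp (f t))"
  shows "0 < (\<integral>t. exp (f t) \<partial>M)"
proof -
  have "(\<integral>t. exp (f t) \<partial>M) \<noteq> 0"
  proof
    assume "(\<integral>t. exp (f t) \<partial>M) = 0"
    then have "AE t in M. exp (f t) = 0"
      using integral_nonneg_eq_0_iff_AE[OF assms] by simp
    then have "AE t in M. False" by simp
    then show False by simp
  qed
  then show ?thesis by (simp add: less_le Bochner_Integration.integral_nonneg)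
qed

lemma exp_minus_linear_zero_iff: "exp x - 1 - x = 0 \<longleftrightarrow> x = (0::real)"
proof
  assume *: "exp x - 1 - x = 0"
  \<comment> \<open>With \<open>y = exp (x/2) \<ge> 1 + x/2\<close>, the equation \<open>y\<^sup>2 = 1 + x\<close> gives \<open>(y - 1)\<^sup>2 \<le> 0\<close>.\<close>
  show "x = 0"
  proof (rule ccontr)
    assume "x \<noteq> 0"
    then have h: "exp (x/2) > 0" "1 + x/2 \<le> exp (x/2)" by auto
    have "exp x = exp (x/2) ^ 2" by (simp add: power2_eq_square exp_add[symmetric])
    then have "1 + x = exp (x/2) ^ 2" using * by simp
    moreover have "(exp (x/2) - 1)^2 > 0" using \<open>x \<noteq> 0\<close> by simp
    ultimately show False using h by (simp add: power2_eq_square algebra_simps)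
  qed
qed simp

text \<open>The linear form of Jensen's inequality for \<open>exp\<close>: with \<open>1 + x\<close> as the lower bound, the equality
  case comes directly from the strict positivity of \<open>exp x - 1 - x\<close> away from \<open>0\<close>.\<close>
lemma (in prob_space) one_plus_expectation_le_expectation_exp:
  fixes f :: "'a \<Rightarrow> real"
  assumes 1: "integrable M f" and 2: "integrable M (\<lambda>t. exp (f t))"
  shows "1 + (\<integral>t. f t \<partial>M) \<le> (\<integral>t. exp (f t) \<partial>M)"
    and "1 + (\<integral>t. f t \<partial>M) = (\<integral>t. exp (f t) \<partial>M) \<longleftrightarrow> (AE t in M. f t = 0)"
proof -
  have i: "integrable M (\<lambda>t. exp (f t) - 1 - f t)" using assms by auto
  have eq: "(\<integral>t. exp (f t) - 1 - f t \<partial>M) = (\<integral>t. exp (f t) \<partial>M) - 1 - (\<integral>t. f t \<partial>M)"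
    using assms by (simp add: prob_space)
  have nn: "0 \<le> exp (f t) - 1 - f t" for t using exp_ge_add_one_self[of "f t"] by linarith
  have "0 \<le> (\<integral>t. exp (f t) - 1 - f t \<partial>M)" by (rule Bochner_Integration.integral_nonneg) (rule nn)
  then show "1 + (\<integral>t. f t \<partial>M) \<le> (\<integral>t. exp (f t) \<partial>M)" using eq by linarith
  have "(\<integral>t. exp (f t) - 1 - f t \<partial>M) = 0 \<longleftrightarrow> (AE t in M. exp (f t) - 1 - f t = 0)"
    by (rule integral_nonneg_eq_0_iff_AE[OF i]) (use nn in auto)
  then show "1 + (\<integral>t. f t \<partial>M) = (\<integral>t. exp (f t) \<partial>M) \<longleftrightarrow> (AE t in M. f t = 0)"
    unfolding exp_minus_linear_zero_iff eq by linarith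
qed

text \<open>Let \<open>h\<close> solve the Poisson equation for the mean drift, so that \<open>t + h j - h i\<close> averages to \<open>0\<close>
  from each state \<open>i\<close>. For \<open>v = exp (s h)\<close> the quotient \<open>(T v) i / v i\<close> is the mean of
  \<open>exp (s (t + h j - h i))\<close>, which is at least \<open>1\<close>, with equality only if these centred steps vanish
  almost surely. The non-degeneracy assumption excludes equality at some state. It is stated for all
  potentials \<open>h\<close>, since the solution of the Poisson equation is found only inside the proof.\<close>
lemma tilted_matrix_strictly_subharmonic:
  fixes P :: "real^'e^('e::finite)"
  assumes tm: "transition_matrix P" and irr: "irreducible_matrix P"
    and inv: "invariant_probability P \<nu>"
    and pF: "\<And>i j. prob_space (F i j)"
    and intF: "\<And>i j. integrable (F i j) (\<lambda>t. t)"
    and intE: "\<And>i j. integrable (F i j) (\<lambda>t. exp (s * t))"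
    and centred: "hyp_H3 P \<nu> F"
    and nondeg: "\<And>h::'e \<Rightarrow> real. \<exists>x j. 0 < P $ x $ j \<and> \<not> (AE t in F x j. t = h x - h j)"
    and s: "s \<noteq> 0"
  shows "\<exists>u. (\<forall>i. 0 < u $ i) \<and> (\<forall>i. u $ i < (tilted_matrix P F s *v u) $ i)"
proof -
  have P0: "\<And>i j. 0 \<le> P $ i $ j" and P1: "\<And>i. (\<Sum>j\<in>UNIV. P $ i $ j) = 1"
    using tm by (auto simp: transition_matrix_def)
  define m :: "real^'e" where "m = (\<chi> i. \<Sum>j\<in>UNIV. P $ i $ j * (\<integral>t. t \<partial>F i j))"
  have "\<nu> \<bullet> m = (\<Sum>i\<in>UNIV. \<Sum>j\<in>UNIV. \<nu> $ i * P $ i $ j * (\<integral>t. t \<partial>F i j))"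
    by (simp add: inner_vec_def m_def sum_distrib_left mult.assoc)
  also have "\<dots> = 0"
    using centred by (simp add: hyp_H3_def sum.cartesian_product UNIV_Times_UNIV[symmetric]
        del: UNIV_Times_UNIV)
  finally obtain h where h: "h - P *v h = m"
    using poisson_equation_solvable[OF tm irr inv] by blast
  have hm: "(\<Sum>j\<in>UNIV. P $ i $ j * ((\<integral>t. t \<partial>F i j) + h $ j - h $ i)) = 0" for i
  proof -
    have "h $ i - (\<Sum>j\<in>UNIV. P $ i $ j * h $ j) = (\<Sum>j\<in>UNIV. P $ i $ j * (\<integral>t. t \<partial>F i j))"
      using h by (simp add: vec_eq_iff m_def matrix_vector_mult_def)
    moreover have "(\<Sum>j\<in>UNIV. P $ i $ j * h $ i) = h $ i"
      by (simp add: sum_distrib_right[symmetric] P1)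
    ultimately show ?thesis
      by (simp add: algebra_simps sum.distrib sum_subtractf)
  qed
  define Z where "Z i j t = s * (t + h $ j - h $ i)" for i j t
  define v :: "real^'e" where "v = (\<chi> i. exp (s * h $ i))"
  let ?T = "tilted_matrix P F s"
  have Zexp: "exp (Z i j t) = exp (s * t) * exp (s * h $ j) / exp (s * h $ i)" for i j t
    by (simp add: Z_def exp_add[symmetric] exp_diff[symmetric] algebra_simps)
  have iZ: "integrable (F i j) (Z i j)" for i j
  proof -
    interpret prob_space "F i j" by fact
    show ?thesis unfolding Z_def using intF[of i j] by auto
  qed
  have iEZ: "integrable (F i j) (\<lambda>t. exp (Z i j t))" for i j
    unfolding Zexp using intE[of i j] by auto
  have EZ: "(\<integral>t. exp (Z i j t) \<partial>F i j) = (\<integral>t. exp (s * t) \<partial>F i j) * exp (s * h $ j) / exp (s * h $ i)" for i j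
    unfolding Zexp by simp
  have IZ: "(\<integral>t. Z i j t \<partial>F i j) = s * ((\<integral>t. t \<partial>F i j) + h $ j - h $ i)" for i j
  proof -
    interpret prob_space "F i j" by fact
    show ?thesis unfolding Z_def using intF[of i j] by (simp add: prob_space)
  qed
  have Tv: "(?T *v v) $ i / v $ i = (\<Sum>j\<in>UNIV. P $ i $ j * (\<integral>t. exp (Z i j t) \<partial>F i j))" for i
    by (simp add: tilted_matrix_def matrix_vector_mult_def v_def EZ sum_divide_distrib mult.assoc)
  \<comment> \<open>The means of \<open>Z\<close> can be subtracted freely: by \<open>hm\<close> they average to \<open>0\<close>. Every summand
    then has a sign.\<close>
  have gap: "(?T *v v) $ i / v $ i - 1
      = (\<Sum>j\<in>UNIV. P $ i $ j * ((\<integral>t. exp (Z i j t) \<partial>F i j) - 1 - (\<integral>t. Z i j t \<partial>F i j)))" for i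
  proof -
    have "(\<Sum>j\<in>UNIV. P $ i $ j * (\<integral>t. Z i j t \<partial>F i j))
        = s * (\<Sum>j\<in>UNIV. P $ i $ j * ((\<integral>t. t \<partial>F i j) + h $ j - h $ i))"
      unfolding IZ by (simp add: sum_distrib_left mult.left_commute)
    then show ?thesis
      unfolding Tv using hm[of i] by (simp add: right_diff_distrib sum_subtractf P1)
  qed
  have nn: "0 \<le> (\<integral>t. exp (Z i j t) \<partial>F i j) - 1 - (\<integral>t. Z i j t \<partial>F i j)" for i j
    using prob_space.one_plus_expectation_le_expectation_exp(1)[OF pF iZ iEZ, of i j] by linarith
  have v0: "0 < v $ i" for i by (simp add: v_def)
  have sub: "v $ i \<le> (?T *v v) $ i" for i
  proof -
    have "0 \<le> (?T *v v) $ i / v $ i - 1"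
      unfolding gap by (intro sum_nonneg mult_nonneg_nonneg nn P0)
    then show ?thesis using v0[of i] by (simp add: field_simps)
  qed
  obtain x j where xj: "0 < P $ x $ j" "\<not> (AE t in F x j. t = h $ x - h $ j)"
    using nondeg[of "\<lambda>i. h $ i"] by blast
  have "Z x j t = 0 \<longleftrightarrow> t = h $ x - h $ j" for t using s by (auto simp: Z_def)
  then have "1 + (\<integral>t. Z x j t \<partial>F x j) \<noteq> (\<integral>t. exp (Z x j t) \<partial>F x j)"
    using prob_space.one_plus_expectation_le_expectation_exp(2)[OF pF iZ iEZ, of x j] xj(2) by simp
  then have "0 < P $ x $ j * ((\<integral>t. exp (Z x j t) \<partial>F x j) - 1 - (\<integral>t. Z x j t \<partial>F x j))"
    using nn[of x j] xj(1) by (intro mult_pos_pos) linarith+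
  then have "0 < (?T *v v) $ x / v $ x - 1"
    unfolding gap by (intro sum_pos2[of _ j] mult_nonneg_nonneg nn P0) auto
  then have strict: "v $ x < (?T *v v) $ x" using v0[of x] by (simp add: field_simps)
  have Epos: "0 < (\<integral>t. exp (s * t) \<partial>F i j)" for i j
    using prob_space.exp_integral_pos[OF pF intE] .
  have T0: "0 \<le> ?T $ i $ j" and T1: "0 < P $ i $ j \<Longrightarrow> 0 < ?T $ i $ j" for i j
    using Epos[of i j] P0[of i j] by (auto simp: tilted_matrix_def)
  show ?thesis
    using strictly_subharmonic_of_subharmonic[of P ?T v x] irr P0 T0 T1 v0 sub strict by blast
qed

section \<open>The Lyapunov function\<close>

text \<open>Here \<open>s\<close> is the depth of an overshoot below \<open>0\<close>. For \<open>s\<close> below a level \<open>L\<close> the linear growth of \<open>K (1 - exp (- a s))\<close> dominates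
  \<open>\<Phi> (exp (\<epsilon> s) - 1)\<close> if \<open>K\<close> is large; beyond \<open>L\<close> the faster exponential \<open>\<delta> exp (\<alpha> s)\<close> does,
  whatever the value of \<open>K\<close>. The point is that \<open>\<delta>\<close> can be prescribed in advance.\<close>
lemma overshoot_bound:
  fixes \<epsilon> \<alpha> a \<delta> \<Phi> :: real
  assumes "0 < \<epsilon>" "\<epsilon> < \<alpha>" "0 < a" "0 < \<delta>" "0 < \<Phi>"
  shows "\<exists>K>0. \<forall>s\<ge>0. \<Phi> * (exp (\<epsilon> * s) - 1) \<le> K * (1 - exp (- a * s)) + \<delta> * exp (\<alpha> * s)"
proof -
  define L where "L = max 1 (ln (\<Phi> / \<delta>) / (\<alpha> - \<epsilon>))"
  define K where "K = \<Phi> * \<epsilon> * exp ((\<epsilon> + a) * L) / a"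
  have K: "0 < K" using assms by (simp add: K_def)
  have "\<Phi> * (exp (\<epsilon> * s) - 1) \<le> K * (1 - exp (- a * s)) + \<delta> * exp (\<alpha> * s)" if s: "0 \<le> s" for s
  proof (cases "s \<le> L")
    case True
    have "exp (\<epsilon> * s) * (1 - \<epsilon> * s) \<le> exp (\<epsilon> * s) * exp (- (\<epsilon> * s))"
      using exp_ge_add_one_self[of "- (\<epsilon> * s)"] by (intro mult_left_mono) auto
    then have "exp (\<epsilon> * s) - 1 \<le> \<epsilon> * s * exp (\<epsilon> * s)"
      by (simp add: exp_add[symmetric] algebra_simps)
    also have "\<dots> \<le> \<epsilon> * s * exp (\<epsilon> * L)"
      using True s assms by (intro mult_left_mono) auto
    finally have 1: "\<Phi> * (exp (\<epsilon> * s) - 1) \<le> \<Phi> * (\<epsilon> * s * exp (\<epsilon> * L))"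
      using assms by (intro mult_left_mono) auto
    have "exp (- (a * s)) * (1 + a * s) \<le> exp (- (a * s)) * exp (a * s)"
      by (intro mult_left_mono exp_ge_add_one_self) auto
    then have "a * s * exp (- (a * s)) \<le> 1 - exp (- (a * s))"
      by (simp add: exp_add[symmetric] algebra_simps)
    moreover have "a * s * exp (- (a * L)) \<le> a * s * exp (- (a * s))"
      using True s assms by (intro mult_left_mono) auto
    ultimately have "K * (a * s * exp (- (a * L))) \<le> K * (1 - exp (- a * s))"
      using K by (intro mult_left_mono) auto
    moreover have "K * (a * s * exp (- (a * L))) = \<Phi> * (\<epsilon> * s * exp (\<epsilon> * L))"
      using assms by (simp add: K_def exp_add[symmetric] exp_diff[symmetric] algebra_simps exp_minus field_simps)
    moreover have "0 \<le> \<delta> * exp (\<alpha> * s)" using assms by simp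
    ultimately show ?thesis using 1 by linarith
  next
    case False
    then have "ln (\<Phi> / \<delta>) / (\<alpha> - \<epsilon>) \<le> s" by (simp add: L_def)
    then have "ln (\<Phi> / \<delta>) \<le> (\<alpha> - \<epsilon>) * s" using assms by (simp add: field_simps)
    then have "\<Phi> / \<delta> \<le> exp ((\<alpha> - \<epsilon>) * s)"
      using assms by (metis divide_pos_pos exp_le_cancel_iff exp_ln)
    then have "\<Phi> \<le> \<delta> * exp ((\<alpha> - \<epsilon>) * s)" using assms by (simp add: field_simps)
    then have "\<Phi> * exp (\<epsilon> * s) \<le> \<delta> * exp ((\<alpha> - \<epsilon>) * s) * exp (\<epsilon> * s)"
      by (intro mult_right_mono) auto
    also have "\<dots> = \<delta> * exp (\<alpha> * s)" by (simp add: exp_add[symmetric] algebra_simps)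
    finally have "\<Phi> * (exp (\<epsilon> * s) - 1) \<le> \<delta> * exp (\<alpha> * s)"
      using assms by (simp add: algebra_simps)
    moreover have "0 \<le> K * (1 - exp (- a * s))" using K s assms by (intro mult_nonneg_nonneg) auto
    ultimately show ?thesis by linarith
  qed
  then show ?thesis using K by blast
qed

text \<open>The function is \<open>A - \<phi> x exp (- \<epsilon> u)\<close> for \<open>u \<ge> 0\<close>, continued by \<open>exp (a u)\<close> to the left. By the
  overshoot bound it lies below \<open>A - \<phi> x exp (- \<epsilon> u) + \<delta> exp (- \<alpha> u)\<close> on the whole line. The mean
  of this majorant after one step from \<open>d \<ge> 0\<close> is explicit: the strict inequality for \<open>\<phi>\<close> gains at
  least \<open>\<theta> exp (- \<epsilon> d)\<close>, and the last term costs at most \<open>\<delta> C exp (- \<alpha> d) \<le> \<delta> C exp (- \<epsilon> d)\<close>;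
  with \<open>\<delta> = \<theta> / (2 C)\<close>, half of the gain remains. The conclusion uses extended nonnegative
  integrals because it is iterated along the chain in that form.\<close>
lemma lyapunov_function_exists:
  fixes P :: "real^'e^('e::finite)" and \<phi> :: "real^'e"
  assumes tm: "transition_matrix P"
    and pF: "\<And>i j. prob_space (F i j)"
    and int\<epsilon>: "\<And>i j. integrable (F i j) (\<lambda>t. exp (- \<epsilon> * t))"
    and int\<alpha>: "\<And>i j. integrable (F i j) (\<lambda>t. exp (- \<alpha> * t))"
    and par: "0 < \<epsilon>" "\<epsilon> < \<alpha>" "0 < a"
    and \<phi>: "\<And>i. 0 < \<phi> $ i" "\<And>i. \<phi> $ i < (tilted_matrix P F (- \<epsilon>) *v \<phi>) $ i"
  shows "\<exists>(g :: 'e \<Rightarrow> real \<Rightarrow> real) c. 0 < c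
    \<and> (\<forall>x. g x \<in> borel_measurable borel) \<and> (\<forall>x u. 0 \<le> g x u)
    \<and> (\<forall>x u. u < 0 \<longrightarrow> g x u = exp (a * u) * g x 0)
    \<and> (\<forall>x d. 0 \<le> d \<longrightarrow> (\<Sum>j\<in>UNIV. ennreal (P $ x $ j) * (\<integral>\<^sup>+ y. ennreal (g j (d + y)) \<partial>F x j))
          + ennreal (c * exp (- \<epsilon> * d)) \<le> ennreal (g x d))"
proof -
  have P0: "\<And>i j. 0 \<le> P $ i $ j" and P1: "\<And>i. (\<Sum>j\<in>UNIV. P $ i $ j) = 1"
    using tm by (auto simp: transition_matrix_def)
  let ?T = "\<lambda>s. tilted_matrix P F s"
  define \<theta> where "\<theta> = Min (range (\<lambda>i. (?T (- \<epsilon>) *v \<phi>) $ i - \<phi> $ i))"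
  have \<theta>: "0 < \<theta>" "\<theta> \<le> (?T (- \<epsilon>) *v \<phi>) $ i - \<phi> $ i" for i
    using \<phi>(2) by (auto simp: \<theta>_def)
  \<comment> \<open>The summand \<open>1\<close> makes \<open>C\<close> visibly positive, so that it can be divided by.\<close>
  define C where "C = Max (range (\<lambda>i. \<Sum>j\<in>UNIV. ?T (- \<alpha>) $ i $ j)) + 1"
  have Csum: "(\<Sum>j\<in>UNIV. ?T (- \<alpha>) $ i $ j) \<le> C" for i
    unfolding C_def by (rule order_trans[OF Max_ge[of "range (\<lambda>i. \<Sum>j\<in>UNIV. ?T (- \<alpha>) $ i $ j)"]]) auto
  have T0: "0 \<le> (\<Sum>j\<in>UNIV. ?T (- \<alpha>) $ i $ j)" for i
    by (intro sum_nonneg) (simp add: tilted_matrix_def P0)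
  have C: "0 < C"
  proof -
    fix i
    have "(\<Sum>j\<in>UNIV. ?T (- \<alpha>) $ i $ j) \<le> C - 1" by (auto simp: C_def)
    then show ?thesis using T0[of i] by linarith
  qed
  define \<delta> where "\<delta> = \<theta> / (2 * C)"
  have \<delta>: "0 < \<delta>" using \<theta> C by (simp add: \<delta>_def)
  define \<Phi> where "\<Phi> = Max (range (\<lambda>i. \<phi> $ i))"
  have \<Phi>: "\<phi> $ i \<le> \<Phi>" for i by (simp add: \<Phi>_def)
  have \<Phi>0: "0 < \<Phi>" using \<phi>(1) \<Phi> less_le_trans by blast
  obtain K where K: "0 < K"
    "\<And>s. 0 \<le> s \<Longrightarrow> \<Phi> * (exp (\<epsilon> * s) - 1) \<le> K * (1 - exp (- a * s)) + \<delta> * exp (\<alpha> * s)"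
    using overshoot_bound[OF par \<delta> \<Phi>0] by blast
  define A where "A = \<Phi> + K"
  define g where "g x u = (if u < 0 then exp (a * u) * (A - \<phi> $ x) else A - \<phi> $ x * exp (- \<epsilon> * u))" for x u
  have A\<phi>: "K \<le> A - \<phi> $ x" for x using \<Phi>[of x] by (simp add: A_def)
  have gm: "g x \<in> borel_measurable borel" for x
    unfolding g_def by measurable
  have g0: "0 \<le> g x u" for x u
  proof (cases "u < 0")
    case True
    then show ?thesis using A\<phi>[of x] K by (simp add: g_def)
  next
    case False
    then have "\<phi> $ x * exp (- \<epsilon> * u) \<le> \<phi> $ x * 1"
      using par \<phi>(1)[of x] by (intro mult_left_mono) auto
    then show ?thesis using False A\<phi>[of x] K by (simp add: g_def)
  qed
  have gub: "g x u \<le> A - \<phi> $ x * exp (- \<epsilon> * u) + \<delta> * exp (- \<alpha> * u)" for x u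
  proof (cases "u < 0")
    case True
    have nn: "0 \<le> exp (\<epsilon> * - u) - 1" "0 \<le> 1 - exp (- a * - u)"
      using True par by (auto simp: mult_le_0_iff)
    have "\<phi> $ x * (exp (\<epsilon> * - u) - 1) \<le> \<Phi> * (exp (\<epsilon> * - u) - 1)"
      using \<Phi> nn by (intro mult_right_mono) auto
    also have "\<dots> \<le> K * (1 - exp (- a * - u)) + \<delta> * exp (\<alpha> * - u)"
      using K(2)[of "- u"] True by simp
    also have "K * (1 - exp (- a * - u)) \<le> (A - \<phi> $ x) * (1 - exp (- a * - u))"
      using nn A\<phi> by (intro mult_right_mono)
    finally show ?thesis using True by (simp add: g_def algebra_simps)
  qed (use \<delta> in \<open>auto simp: g_def\<close>)
  define c where "c = \<theta> / 2"
  have step: "(\<Sum>j\<in>UNIV. ennreal (P $ x $ j) * (\<integral>\<^sup>+ y. ennreal (g j (d + y)) \<partial>F x j))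
          + ennreal (c * exp (- \<epsilon> * d)) \<le> ennreal (g x d)" if d: "0 \<le> d" for x d
  proof -
    define B where "B j y = A - \<phi> $ j * exp (- \<epsilon> * (d + y)) + \<delta> * exp (- \<alpha> * (d + y))" for j y
    have B: "B j y = A - \<phi> $ j * exp (- \<epsilon> * d) * exp (- \<epsilon> * y) + \<delta> * exp (- \<alpha> * d) * exp (- \<alpha> * y)" for j y
      by (simp add: B_def exp_add[symmetric] algebra_simps)
    have gB: "g j (d + y) \<le> B j y" for j y using gub by (simp add: B_def)
    have B0: "0 \<le> B j y" for j y using g0 gB order_trans by blast
    have iB: "integrable (F x j) (B j)" for j
    proof -
      interpret prob_space "F x j" by fact
      show ?thesis unfolding B using int\<epsilon> int\<alpha> by auto
    qed
    have EB: "(\<integral>y. B j y \<partial>F x j) = A - \<phi> $ j * exp (- \<epsilon> * d) * (\<integral>y. exp (- \<epsilon> * y) \<partial>F x j)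
       + \<delta> * exp (- \<alpha> * d) * (\<integral>y. exp (- \<alpha> * y) \<partial>F x j)" for j
    proof -
      interpret prob_space "F x j" by fact
      show ?thesis unfolding B using int\<epsilon>[of x j] int\<alpha>[of x j] by (simp add: prob_space)
    qed
    have EB0: "0 \<le> (\<integral>y. B j y \<partial>F x j)" for j
      by (rule Bochner_Integration.integral_nonneg) (rule B0)
    have "(\<Sum>j\<in>UNIV. ennreal (P $ x $ j) * (\<integral>\<^sup>+ y. ennreal (g j (d + y)) \<partial>F x j))
        \<le> (\<Sum>j\<in>UNIV. ennreal (P $ x $ j) * (\<integral>\<^sup>+ y. ennreal (B j y) \<partial>F x j))"
      by (intro sum_mono mult_left_mono nn_integral_mono ennreal_leI gB) auto
    also have "\<dots> = (\<Sum>j\<in>UNIV. ennreal (P $ x $ j * (\<integral>y. B j y \<partial>F x j)))"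
      using nn_integral_eq_integral[OF iB] B0 by (simp add: ennreal_mult P0 EB0)
    also have "\<dots> = ennreal (\<Sum>j\<in>UNIV. P $ x $ j * (\<integral>y. B j y \<partial>F x j))"
      by (intro sum_ennreal) (simp add: P0 EB0)
    finally have le: "(\<Sum>j\<in>UNIV. ennreal (P $ x $ j) * (\<integral>\<^sup>+ y. ennreal (g j (d + y)) \<partial>F x j))
        \<le> ennreal (\<Sum>j\<in>UNIV. P $ x $ j * (\<integral>y. B j y \<partial>F x j))" .
    have s0: "0 \<le> (\<Sum>j\<in>UNIV. P $ x $ j * (\<integral>y. B j y \<partial>F x j))"
      by (intro sum_nonneg mult_nonneg_nonneg P0 EB0)
    have c0: "0 \<le> c * exp (- \<epsilon> * d)" using \<theta> by (simp add: c_def)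
    have "(\<Sum>j\<in>UNIV. P $ x $ j * (\<integral>y. B j y \<partial>F x j))
      = A * (\<Sum>j\<in>UNIV. P $ x $ j) - exp (- \<epsilon> * d) * (?T (- \<epsilon>) *v \<phi>) $ x
        + \<delta> * exp (- \<alpha> * d) * (\<Sum>j\<in>UNIV. ?T (- \<alpha>) $ x $ j)"
      unfolding EB
      by (simp add: tilted_matrix_def matrix_vector_mult_def sum_distrib_left
          sum.distrib sum_subtractf algebra_simps)
    also have "\<dots> \<le> A - exp (- \<epsilon> * d) * (\<phi> $ x + \<theta>) + \<delta> * exp (- \<epsilon> * d) * C"
    proof -
      have "exp (- \<epsilon> * d) * (\<phi> $ x + \<theta>) \<le> exp (- \<epsilon> * d) * (?T (- \<epsilon>) *v \<phi>) $ x"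
        using \<theta>(2)[of x] by (intro mult_left_mono) auto
      moreover have "\<delta> * exp (- \<alpha> * d) * (\<Sum>j\<in>UNIV. ?T (- \<alpha>) $ x $ j) \<le> \<delta> * exp (- \<epsilon> * d) * C"
        using \<delta> d par by (intro mult_mono Csum T0 mult_nonneg_nonneg) (auto intro!: mult_right_mono)
      ultimately show ?thesis unfolding P1 mult_1_right by linarith
    qed
    also have "\<dots> = A - \<phi> $ x * exp (- \<epsilon> * d) - c * exp (- \<epsilon> * d)"
      using C by (simp add: \<delta>_def c_def field_simps)
    finally have "(\<Sum>j\<in>UNIV. P $ x $ j * (\<integral>y. B j y \<partial>F x j)) + c * exp (- \<epsilon> * d) \<le> g x d"
      using d by (simp add: g_def)
    then have "ennreal (\<Sum>j\<in>UNIV. P $ x $ j * (\<integral>y. B j y \<partial>F x j)) + ennreal (c * exp (- \<epsilon> * d)) \<le> ennreal (g x d)"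
      using s0 c0 by (simp add: ennreal_plus[symmetric] ennreal_leI del: ennreal_plus)
    then show ?thesis using le by (meson add_right_mono order_trans)
  qed
  have gneg: "g x u = exp (a * u) * g x 0" if "u < 0" for x u using that by (simp add: g_def)
  have "0 < c" using \<theta> by (simp add: c_def)
  then show ?thesis using gm g0 gneg step by (intro exI[of _ g] exI[of _ c]) blast
qed

section \<open>Partial sums, running minimum and the natural filtration\<close>

lemma measurable_natural_filtration:
  assumes "k \<le> n" "\<And>w. w \<in> space M \<Longrightarrow> Z k w \<in> space S"
  shows "Z k \<in> measurable (natural_filtration M S Z n) S"
proof (rule measurableI)
  have sp: "space (natural_filtration M S Z n) = space M"
    by (simp add: natural_filtration_def space_measure_of_conv)
  show "Z k w \<in> space S" if "w \<in> space (natural_filtration M S Z n)" for w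
    using assms(2) that sp by simp
  have gen: "(\<Union>k\<in>{..n}. {Z k -` A \<inter> space M | A. A \<in> sets S}) \<subseteq> Pow (space M)" by auto
  show "Z k -` A \<inter> space (natural_filtration M S Z n) \<in> sets (natural_filtration M S Z n)"
    if "A \<in> sets S" for A
    unfolding sp unfolding natural_filtration_def sets_measure_of[OF gen]
    by (rule sigma_sets.Basic) (use that assms(1) in auto)
qed

lemma subalgebra_natural_filtration:
  assumes "\<And>k. Z k \<in> measurable M S"
  shows "subalgebra M (natural_filtration M S Z n)"
proof -
  have gen: "(\<Union>k\<in>{..n}. {Z k -` A \<inter> space M | A. A \<in> sets S}) \<subseteq> Pow (space M)" by auto
  have "(\<Union>k\<in>{..n}. {Z k -` A \<inter> space M | A. A \<in> sets S}) \<subseteq> sets M"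
    using assms by (auto intro: measurable_sets)
  then show ?thesis
    unfolding subalgebra_def natural_filtration_def sets_measure_of[OF gen]
    by (simp add: space_measure_of_conv sets.sigma_sets_subset)
qed

lemma partial_sum_0: "partial_sum Y 0 w = 0"
  by (simp add: partial_sum_def)

lemma partial_sum_Suc: "partial_sum Y (Suc n) w = partial_sum Y n w + Y (Suc n) w"
  by (simp add: partial_sum_def)

lemma running_min_0: "running_min Y 0 w = 0"
  by (simp add: running_min_def partial_sum_0)

lemma running_min_Suc: "running_min Y (Suc n) w = min (running_min Y n w) (partial_sum Y (Suc n) w)"
proof -
  have "{..Suc n} = insert (Suc n) {..n}" by auto
  then show ?thesis unfolding running_min_def by (simp add: min.commute)
qed

lemma running_min_le: "running_min Y n w \<le> partial_sum Y n w"
  unfolding running_min_def by (rule Min_le) auto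

text \<open>The \<open>\<sigma>\<close>-algebra is left free in the next two lemmas, so that they apply both to the whole space
  and to the past of the chain.\<close>
lemma partial_sum_measurable:
  assumes "\<And>k. k \<le> n \<Longrightarrow> Y k \<in> borel_measurable N"
  shows "partial_sum Y n \<in> borel_measurable N"
  unfolding partial_sum_def using assms by (intro borel_measurable_sum) auto

lemma running_min_measurable:
  assumes "\<And>k. k \<le> n \<Longrightarrow> Y k \<in> borel_measurable N"
  shows "running_min Y n \<in> borel_measurable N"
  using assms
proof (induction n)
  case (Suc n)
  have "running_min Y n \<in> borel_measurable N" using Suc by auto
  moreover have "partial_sum Y (Suc n) \<in> borel_measurable N"
    by (rule partial_sum_measurable) (use Suc in auto)
  ultimately show ?case unfolding running_min_Suc[abs_def] by simp
qed (simp add: running_min_0[abs_def])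

section \<open>One step of the chain\<close>

context markov_additive_chain
begin

abbreviation past :: "nat \<Rightarrow> 'w measure" where
  "past \<equiv> natural_filtration M (borel \<Otimes>\<^sub>M count_space UNIV) (\<lambda>k w. (Y k w, X k w))"

lemma pair_measurable: "(\<lambda>w. (Y k w, X k w)) \<in> measurable M (borel \<Otimes>\<^sub>M count_space UNIV)"
  using Y_measurable X_measurable by (rule measurable_Pair)

lemma subalgebra_past: "subalgebra M (past n)"
  by (rule subalgebra_natural_filtration) (rule pair_measurable)

lemma pair_measurable_past:
  assumes "k \<le> n"
  shows "(\<lambda>w. (Y k w, X k w)) \<in> measurable (past n) (borel \<Otimes>\<^sub>M count_space UNIV)"
  using assms by (rule measurable_natural_filtration) (simp add: space_pair_measure)

lemma Y_measurable_past: "k \<le> n \<Longrightarrow> Y k \<in> borel_measurable (past n)"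
  using measurable_compose[OF pair_measurable_past measurable_fst] by simp

lemma X_measurable_past: "k \<le> n \<Longrightarrow> X k \<in> measurable (past n) (count_space UNIV)"
  using measurable_compose[OF pair_measurable_past measurable_snd] by simp

lemma measurable_from_past: "R \<in> measurable (past n) N \<Longrightarrow> R \<in> measurable M N"
  using measurable_from_subalg[OF subalgebra_past] .

lemma X_event [measurable]: "{w \<in> space M. X n w = x} \<in> sets M"
  using measurable_sets[OF X_measurable, of "{x}" n] by (simp add: vimage_def Int_def conj_commute)

lemma emeasure_transition:
  assumes G: "G \<in> sets (past n)" "\<And>w. w \<in> G \<Longrightarrow> X n w = x" and A: "A \<in> sets borel"
    and P0: "0 \<le> P $ x $ j"
  shows "emeasure M {w \<in> G. Y (Suc n) w \<in> A \<and> X (Suc n) w = j}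
    = ennreal (P $ x $ j * measure (F x j) A) * emeasure M G"
proof -
  interpret sub: finite_measure_subalgebra M "past n"
    by (intro finite_measure_subalgebra.intro finite_measure_subalgebra_axioms.intro
        subalgebra_past finite_measure_axioms)
  let ?E = "{w \<in> space M. Y (Suc n) w \<in> A \<and> X (Suc n) w = j}"
  have GM: "G \<in> sets M" using G(1) subalgebra_past by (auto simp: subalgebra_def)
  have E: "?E \<in> sets M"
  proof -
    have "?E = (Y (Suc n) -` A \<inter> space M) \<inter> {w \<in> space M. X (Suc n) w = j}" by auto
    then show ?thesis using measurable_sets[OF Y_measurable A] by auto
  qed
  have "measure M (G \<inter> ?E) = (\<integral>w. (indicator G w * indicator ?E w :: real) \<partial>M)"
  proof -
    have "(\<integral>w. (indicator G w * indicator ?E w :: real) \<partial>M) = (\<integral>w. (indicator (G \<inter> ?E) w :: real) \<partial>M)"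
      by (intro Bochner_Integration.integral_cong) (auto simp: indicator_def)
    also have "\<dots> = measure M (G \<inter> ?E)" using GM E by (simp add: sets.sets_into_space Int_absorb1)
    finally show ?thesis ..
  qed
  also have "\<dots> = (\<integral>w\<in>G. indicator ?E w \<partial>M)" by (simp add: set_lebesgue_integral_def)
  also have "\<dots> = (\<integral>w\<in>G. real_cond_exp M (past n) (indicator ?E) w \<partial>M)"
  proof (rule sub.real_cond_exp_intA[OF _ G(1)])
    show "integrable M (indicator ?E :: 'w \<Rightarrow> real)"
      by (rule integrable_real_indicator[OF E]) (simp add: emeasure_eq_measure)
  qed
  also have "\<dots> = (\<integral>w\<in>G. P $ x $ j * measure (F x j) A \<partial>M)"
    unfolding set_lebesgue_integral_def
  proof (rule Bochner_Integration.integral_cong_AE)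
    show "AE w in M. indicator G w *\<^sub>R real_cond_exp M (past n) (indicator ?E) w
        = indicator G w *\<^sub>R (P $ x $ j * measure (F x j) A)"
      using transition[OF A, of n j] by eventually_elim (auto simp: indicator_def G(2))
  qed (use GM in auto)
  also have "\<dots> = P $ x $ j * measure (F x j) A * measure M G"
    using GM by (simp add: set_lebesgue_integral_def sets.sets_into_space Int_absorb1)
  finally have "measure M (G \<inter> ?E) = P $ x $ j * measure (F x j) A * measure M G" .
  moreover have "G \<inter> ?E = {w \<in> G. Y (Suc n) w \<in> A \<and> X (Suc n) w = j}"
    using GM sets.sets_into_space by blast
  ultimately show ?thesis
    using P0 by (simp add: emeasure_eq_measure ennreal_mult)
qed

text \<open>The Markov property for functions of the past and the next step. On the event that the chain moves
  from \<open>x\<close> to \<open>j\<close>, the joint law of a past variable \<open>R\<close> and of \<open>Y (Suc n)\<close> is the product of the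
  law of \<open>R\<close> on \<open>X n = x\<close> with the measure \<open>P $ x $ j * F x j\<close>: both measures agree on rectangles, where the
  claim is the defining property of the conditional expectation. Fixing the two states is what
  turns the transition kernel into a true product, so that Tonelli's theorem applies.\<close>
lemma nn_integral_transition:
  assumes pF: "prob_space (F x j)" and sF: "sets (F x j) = sets borel"
    and P0: "0 \<le> P $ x $ j"
    and R: "R \<in> measurable (past n) N"
    and f: "case_prod f \<in> borel_measurable (N \<Otimes>\<^sub>M borel)"
  shows "(\<integral>\<^sup>+ w. f (R w) (Y (Suc n) w) * indicator {w \<in> space M. X n w = x \<and> X (Suc n) w = j} w \<partial>M)
    = ennreal (P $ x $ j) * (\<integral>\<^sup>+ w. (\<integral>\<^sup>+ y. f (R w) y \<partial>F x j) * indicator {w \<in> space M. X n w = x} w \<partial>M)"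
proof -
  let ?p = "ennreal (P $ x $ j)"
  let ?Ex = "{w \<in> space M. X n w = x}"
  let ?Exj = "{w \<in> space M. X n w = x \<and> X (Suc n) w = j}"
  interpret F: prob_space "F x j" by fact
  have RM: "R \<in> measurable M N" using measurable_from_past[OF R] .
  have Exj: "?Exj \<in> sets M"
  proof -
    have "?Exj = ?Ex \<inter> {w \<in> space M. X (Suc n) w = j}" by auto
    then show ?thesis by simp
  qed
  have RY: "(\<lambda>w. (R w, Y (Suc n) w)) \<in> measurable M (N \<Otimes>\<^sub>M borel)"
    using RM Y_measurable by (rule measurable_Pair)
  define K where "K = distr (density M (indicator ?Ex)) N R"
  define Q where "Q = distr (density M (indicator ?Exj)) (N \<Otimes>\<^sub>M borel) (\<lambda>w. (R w, Y (Suc n) w))"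
  define S where "S = scale_measure ?p (F x j)"
  have K: "emeasure K B = emeasure M (R -` B \<inter> ?Ex)" if "B \<in> sets N" for B
  proof -
    have [measurable]: "R -` B \<inter> space M \<in> sets M" using measurable_sets[OF RM that] .
    have "emeasure K B = (\<integral>\<^sup>+ w. indicator ?Ex w * indicator (R -` B \<inter> space M) w \<partial>M)"
      unfolding K_def using RM that
      by (subst emeasure_distr) (auto simp: emeasure_density)
    also have "\<dots> = (\<integral>\<^sup>+ w. indicator (R -` B \<inter> ?Ex) w \<partial>M)"
      by (intro nn_integral_cong) (auto simp: indicator_def)
    also have "\<dots> = emeasure M (R -` B \<inter> ?Ex)"
    proof (rule nn_integral_indicator)
      have "R -` B \<inter> ?Ex = (R -` B \<inter> space M) \<inter> ?Ex" by auto
      then show "R -` B \<inter> ?Ex \<in> sets M" by simp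
    qed
    finally show ?thesis .
  qed
  have Q: "emeasure Q (B \<times> A) = emeasure M {w \<in> R -` B \<inter> ?Ex. Y (Suc n) w \<in> A \<and> X (Suc n) w = j}"
    if B: "B \<in> sets N" and A: "A \<in> sets borel" for A B
  proof -
    have [measurable]: "R -` B \<inter> space M \<in> sets M" "Y (Suc n) -` A \<inter> space M \<in> sets M"
      using measurable_sets[OF RM B] measurable_sets[OF Y_measurable A] by auto
    have eq: "(\<lambda>w. (R w, Y (Suc n) w)) -` (B \<times> A) \<inter> space M
        = (R -` B \<inter> space M) \<inter> (Y (Suc n) -` A \<inter> space M)" by auto
    have "emeasure Q (B \<times> A) = (\<integral>\<^sup>+ w. indicator ?Exj w
        * indicator ((R -` B \<inter> space M) \<inter> (Y (Suc n) -` A \<inter> space M)) w \<partial>M)"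
      unfolding Q_def using RY A B Exj
      by (subst emeasure_distr) (auto simp: emeasure_density eq)
    also have "\<dots> = (\<integral>\<^sup>+ w. indicator (?Exj \<inter> ((R -` B \<inter> space M) \<inter> (Y (Suc n) -` A \<inter> space M))) w \<partial>M)"
      by (intro nn_integral_cong) (auto simp: indicator_def)
    also have "\<dots> = emeasure M (?Exj \<inter> ((R -` B \<inter> space M) \<inter> (Y (Suc n) -` A \<inter> space M)))"
      using Exj by (intro nn_integral_indicator) auto
    also have "?Exj \<inter> ((R -` B \<inter> space M) \<inter> (Y (Suc n) -` A \<inter> space M))
        = {w \<in> R -` B \<inter> ?Ex. Y (Suc n) w \<in> A \<and> X (Suc n) w = j}" by auto
    finally show ?thesis .
  qed
  have spK: "finite_measure K"
  proof (rule finite_measureI)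
    have "emeasure K (space K) = emeasure M (R -` space N \<inter> ?Ex)"
      using K[OF sets.top] by (simp add: K_def)
    then show "emeasure K (space K) \<noteq> \<infinity>" by (simp add: emeasure_eq_measure)
  qed
  have S_em: "emeasure S A = ?p * emeasure (F x j) A" for A by (simp add: S_def)
  have spS: "finite_measure S"
    by (rule finite_measureI) (simp add: S_em F.emeasure_eq_measure ennreal_mult_eq_top_iff)
  have sets: "sets (K \<Otimes>\<^sub>M S) = sets Q"
    unfolding Q_def sets_distr by (rule sets_pair_measure_cong) (simp_all add: K_def S_def sF)
  have prod: "K \<Otimes>\<^sub>M S = Q"
  proof (rule pair_measure_eqI[OF _ _ sets])
    show "sigma_finite_measure K" "sigma_finite_measure S"
      using spK spS by (simp_all add: finite_measure_def)
    fix B A assume "B \<in> sets K" "A \<in> sets S"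
    then have B: "B \<in> sets N" and A: "A \<in> sets borel" by (auto simp: K_def S_def sF)
    have "R -` B \<inter> ?Ex \<in> sets (past n)"
    proof -
      have sp: "space (past n) = space M" using subalgebra_past by (simp add: subalgebra_def)
      have "R -` B \<inter> ?Ex = (R -` B \<inter> space (past n)) \<inter> (X n -` {x} \<inter> space (past n))"
        unfolding sp by auto
      then show ?thesis
        using measurable_sets[OF R B] measurable_sets[OF X_measurable_past[of n n], of "{x}"] by auto
    qed
    from emeasure_transition[OF this _ A P0]
    have "emeasure Q (B \<times> A) = ennreal (P $ x $ j * measure (F x j) A) * emeasure K B"
      unfolding Q[OF B A] K[OF B] by auto
    then show "emeasure K B * emeasure S A = emeasure Q (B \<times> A)"
      by (simp add: S_em F.emeasure_eq_measure ennreal_mult P0 ac_simps)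
  qed
  interpret S: sigma_finite_measure S using spS by (simp add: finite_measure_def)
  have fKS: "case_prod f \<in> borel_measurable (K \<Otimes>\<^sub>M S)"
  proof -
    have "sets (K \<Otimes>\<^sub>M S) = sets (N \<Otimes>\<^sub>M borel)"
      by (rule sets_pair_measure_cong) (simp_all add: K_def S_def sF)
    from measurable_cong_sets[OF this refl, of borel] show ?thesis using f by blast
  qed
  have fS: "(\<lambda>y. f r y) \<in> borel_measurable (F x j)" if "r \<in> space N" for r
    using measurable_Pair2[OF f that] sF by (simp add: measurable_cong_sets[OF sF refl])
  have inner: "(\<lambda>r. \<integral>\<^sup>+ y. f r y \<partial>S) \<in> borel_measurable N"
    using S.borel_measurable_nn_integral_fst[OF fKS] by (simp add: K_def)
  have "(\<integral>\<^sup>+ w. f (R w) (Y (Suc n) w) * indicator ?Exj w \<partial>M) = (\<integral>\<^sup>+ z. case_prod f z \<partial>Q)"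
    unfolding Q_def
    by (subst nn_integral_distr)
      (use RY f Exj in \<open>auto simp: nn_integral_density measurable_compose[OF RY f, simplified] mult.commute\<close>)
  also have "\<dots> = (\<integral>\<^sup>+ r. \<integral>\<^sup>+ y. f r y \<partial>S \<partial>K)"
    unfolding prod[symmetric] using S.nn_integral_fst[OF fKS] by simp
  also have "\<dots> = (\<integral>\<^sup>+ w. (\<integral>\<^sup>+ y. f (R w) y \<partial>S) * indicator ?Ex w \<partial>M)"
    unfolding K_def
    by (subst nn_integral_distr)
      (use RM inner in \<open>auto simp: nn_integral_density measurable_compose[OF RM inner] mult.commute\<close>)
  also have "\<dots> = (\<integral>\<^sup>+ w. ?p * ((\<integral>\<^sup>+ y. f (R w) y \<partial>F x j) * indicator ?Ex w) \<partial>M)"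
  proof (intro nn_integral_cong)
    fix w assume "w \<in> space M"
    then have "R w \<in> space N" using RM by (meson measurable_space)
    then show "(\<integral>\<^sup>+ y. f (R w) y \<partial>S) * indicator ?Ex w
        = ?p * ((\<integral>\<^sup>+ y. f (R w) y \<partial>F x j) * indicator ?Ex w)"
      unfolding S_def by (simp add: nn_integral_scale_measure fS mult.assoc)
  qed
  also have "\<dots> = ?p * (\<integral>\<^sup>+ w. (\<integral>\<^sup>+ y. f (R w) y \<partial>F x j) * indicator ?Ex w \<partial>M)"
  proof (rule nn_integral_cmult)
    have "case_prod f \<in> borel_measurable (N \<Otimes>\<^sub>M F x j)"
      using f measurable_cong_sets[OF sets_pair_measure_cong[OF refl sF, of N] refl] by blast
    from measurable_compose[OF RM F.borel_measurable_nn_integral_fst[OF this]]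
    show "(\<lambda>w. (\<integral>\<^sup>+ y. f (R w) y \<partial>F x j) * indicator ?Ex w) \<in> borel_measurable M"
      by auto
  qed
  finally show ?thesis .
qed

end

section \<open>The walk is not a coboundary\<close>

lemma has_ac_component_not_point_mass:
  assumes "has_ac_component \<mu>"
  shows "emeasure \<mu> (UNIV - {z}) \<noteq> 0"
proof
  assume 0: "emeasure \<mu> (UNIV - {z}) = 0"
  obtain \<mu>a \<mu>s where ac: "sets \<mu>a = sets borel" "absolutely_continuous lborel \<mu>a" "emeasure \<mu>a UNIV \<noteq> 0"
    "\<forall>A\<in>sets borel. emeasure \<mu> A = emeasure \<mu>a A + emeasure \<mu>s A"
    using assms unfolding has_ac_component_def by blast
  have 1: "emeasure \<mu>a (UNIV - {z}) = 0" using ac(4) 0 by auto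
  have "{z} \<in> null_sets lborel" by (rule finite_imp_null_set_lborel) simp
  then have "{z} \<in> null_sets \<mu>a" using ac(2) unfolding absolutely_continuous_def by blast
  moreover have "UNIV - {z} \<in> null_sets \<mu>a" using 1 ac(1) by (auto simp: null_sets_def)
  ultimately have "{z} \<union> (UNIV - {z}) \<in> null_sets \<mu>a" by (rule null_sets.Un)
  then show False using ac(3) by auto
qed

context markov_additive_chain
begin

text \<open>If every admissible step is the difference of a potential at its endpoints, the sum telescopes.\<close>
lemma coboundary_increments:
  assumes pF: "\<And>x j. prob_space (F x j)" and sF: "\<And>x j. sets (F x j) = sets borel"
    and P0: "\<And>x j. 0 \<le> P $ x $ j"
    and deg: "\<And>x j. 0 < P $ x $ j \<Longrightarrow> AE t in F x j. t = h x - h j"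
  shows "AE w in M. \<forall>n. partial_sum Y n w = h i - h (X n w)"
proof -
  have 1: "AE w in M. X n w = x \<and> X (Suc n) w = j \<longrightarrow> Y (Suc n) w = h x - h j" for n x j
  proof -
    let ?z = "h x - h j"
    let ?E = "{w \<in> space M. X n w = x \<and> X (Suc n) w = j}"
    \<comment> \<open>Only the last step matters here, so the past variable is taken constant.\<close>
    let ?f = "\<lambda>(r::real) y. indicator (UNIV - {?z}) y :: ennreal"
    have E: "?E \<in> sets M"
    proof -
      have "?E = {w \<in> space M. X n w = x} \<inter> {w \<in> space M. X (Suc n) w = j}" by auto
      then show ?thesis by simp
    qed
    have f: "case_prod ?f \<in> borel_measurable (borel \<Otimes>\<^sub>M borel)"
      by measurable
    have "(\<integral>\<^sup>+ w. ?f 0 (Y (Suc n) w) * indicator ?E w \<partial>M)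
      = ennreal (P $ x $ j) * (\<integral>\<^sup>+ w. (\<integral>\<^sup>+ y. ?f 0 y \<partial>F x j) * indicator {w \<in> space M. X n w = x} w \<partial>M)"
      by (rule nn_integral_transition[where R = "\<lambda>_. 0", OF pF sF P0 _ f]) simp
    also have "\<dots> = 0"
    proof (cases "P $ x $ j = 0")
      case False
      then have "AE t in F x j. t = ?z" using P0[of x j] by (intro deg) auto
      then have "AE t in F x j. ?f 0 t = 0" by eventually_elim auto
      then have "(\<integral>\<^sup>+ y. ?f 0 y \<partial>F x j) = 0"
        using sF[of x j] by (subst nn_integral_0_iff_AE) auto
      then show ?thesis by simp
    qed simp
    finally have "(\<integral>\<^sup>+ w. ?f 0 (Y (Suc n) w) * indicator ?E w \<partial>M) = 0" .
    moreover note [measurable] = E Y_measurable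
    ultimately have "AE w in M. ?f 0 (Y (Suc n) w) * indicator ?E w = 0"
      by (subst (asm) nn_integral_0_iff_AE) measurable
    then show ?thesis
      using AE_space by eventually_elim (auto simp: indicator_def split: if_splits)
  qed
  have "AE w in M. \<forall>x\<in>UNIV. \<forall>j\<in>UNIV. X n w = x \<and> X (Suc n) w = j \<longrightarrow> Y (Suc n) w = h x - h j" for n
    by (intro AE_finite_allI[OF finite] 1)
  then have "AE w in M. Y (Suc n) w = h (X n w) - h (X (Suc n) w)" for n
    by simp
  then have "AE w in M. \<forall>n. Y (Suc n) w = h (X n w) - h (X (Suc n) w)"
    by (simp add: AE_all_countable)
  then show ?thesis
    using start
  proof eventually_elim
    case (elim w)
    have "partial_sum Y n w = h i - h (X n w)" for n
      by (induction n) (use elim in \<open>auto simp: partial_sum_0 partial_sum_Suc\<close>)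
    then show ?case by blast
  qed
qed

text \<open>Otherwise, on \<open>X n = j\<close>, the sum would be the single value \<open>h i - h j\<close>, a Lebesgue null set.\<close>
lemma increments_not_coboundary:
  assumes pF: "\<And>x j. prob_space (F x j)" and sF: "\<And>x j. sets (F x j) = sets borel"
    and P0: "\<And>x j. 0 \<le> P $ x $ j"
    and ac: "has_ac_component (sum_law_on M Y X n j)"
  shows "\<exists>x j. 0 < P $ x $ j \<and> \<not> (AE t in F x j. t = h x - h j)"
proof (rule ccontr)
  assume "\<not> ?thesis"
  then have ae: "AE w in M. \<forall>n. partial_sum Y n w = h i - h (X n w)"
    using coboundary_increments[OF pF sF P0, of h] by blast
  let ?E = "{w \<in> space M. X n w = j}"
  let ?A = "UNIV - {h i - h j}"
  have S: "partial_sum Y n \<in> borel_measurable M"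
    by (rule partial_sum_measurable) (rule Y_measurable)
  have "emeasure (sum_law_on M Y X n j) ?A
      = emeasure (restrict_space M ?E) (partial_sum Y n -` ?A \<inter> space (restrict_space M ?E))"
    unfolding sum_law_on_def
    by (rule emeasure_distr) (auto intro: measurable_restrict_space1 S)
  also have "\<dots> = emeasure M (partial_sum Y n -` ?A \<inter> ?E)"
    by (subst emeasure_restrict_space) (auto simp: space_restrict_space Int_absorb1 intro!: arg_cong[where f="emeasure M"])
  also have "\<dots> = 0"
  proof -
    have "AE w in M. w \<notin> partial_sum Y n -` ?A \<inter> ?E"
      using ae by eventually_elim auto
    moreover have "partial_sum Y n -` ?A \<inter> ?E \<in> sets M"
    proof -
      have "partial_sum Y n -` ?A \<inter> ?E = (partial_sum Y n -` ?A \<inter> space M) \<inter> ?E" by auto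
      then show ?thesis using measurable_sets[OF S, of ?A] by auto
    qed
    ultimately have "partial_sum Y n -` ?A \<inter> ?E \<in> null_sets M"
      using AE_iff_null_sets by blast
    then show ?thesis by (rule null_setsD1)
  qed
  finally show False using has_ac_component_not_point_mass[OF ac] by blast
qed

end

section \<open>Summation along the chain\<close>

context markov_additive_chain
begin

text \<open>With \<open>V n\<close> the mean of \<open>exp (a m\<^sub>n) * g X\<^sub>n D\<^sub>n\<close> and \<open>U n\<close> the mean of
  \<open>exp (a m\<^sub>n - \<epsilon> D\<^sub>n)\<close>, the Lyapunov inequality gives \<open>V (Suc n) + c U n \<le> V n\<close>. Summation yields
  \<open>c (U 0 + U 1 + \<dots>) \<le> V 0\<close>, and \<open>V 0\<close> is finite because \<open>m\<^sub>0 = D\<^sub>0 = 0\<close>.\<close>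
lemma weighted_occupation_finite:
  fixes g :: "'e \<Rightarrow> real \<Rightarrow> real"
  assumes pF: "\<And>x j. prob_space (F x j)" and sF: "\<And>x j. sets (F x j) = sets borel"
    and P0: "\<And>x j. 0 \<le> P $ x $ j"
    and c: "0 < c"
    and gm: "\<And>x. g x \<in> borel_measurable borel" and g0: "\<And>x u. 0 \<le> g x u"
    and gneg: "\<And>x u. u < 0 \<Longrightarrow> g x u = exp (a * u) * g x 0"
    and gstep: "\<And>x d. 0 \<le> d \<Longrightarrow>
      (\<Sum>j\<in>UNIV. ennreal (P $ x $ j) * (\<integral>\<^sup>+ y. ennreal (g j (d + y)) \<partial>F x j))
        + ennreal (c * exp (- \<epsilon> * d)) \<le> ennreal (g x d)"
  shows "(\<Sum>n. \<integral>\<^sup>+ w. ennreal (exp (a * running_min Y n w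
      - \<epsilon> * (partial_sum Y n w - running_min Y n w))) \<partial>M) < \<infinity>"
proof -
  note [measurable] = gm
  let ?m = "running_min Y" and ?S = "partial_sum Y"
  define D where "D n w = ?S n w - ?m n w" for n w
  have D0: "0 \<le> D n w" for n w using running_min_le by (simp add: D_def)
  have Sp: "?S n \<in> borel_measurable (past n)" and mp: "?m n \<in> borel_measurable (past n)" for n
    using partial_sum_measurable running_min_measurable Y_measurable_past by blast+
  note [measurable] = measurable_from_past[OF Sp] measurable_from_past[OF mp]
  have [measurable]: "D n \<in> borel_measurable M" for n unfolding D_def[abs_def] by measurable
  define I where "I n x = (indicator {w \<in> space M. X n w = x} :: 'w \<Rightarrow> ennreal)" for n x
  have [measurable]: "I n x \<in> borel_measurable M" for n x unfolding I_def by measurable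
  have I1: "(\<Sum>x\<in>UNIV. I n x w) = 1" if "w \<in> space M" for n w
  proof -
    have "(\<Sum>x\<in>UNIV. I n x w) = (\<Sum>x\<in>UNIV. if x = X n w then 1 else 0)"
      by (intro sum.cong) (use that in \<open>auto simp: I_def\<close>)
    then show ?thesis by simp
  qed
  define V where "V n = (\<Sum>x\<in>UNIV. \<integral>\<^sup>+ w. ennreal (exp (a * ?m n w) * g x (D n w)) * I n x w \<partial>M)" for n
  define U where "U n = (\<integral>\<^sup>+ w. ennreal (exp (a * ?m n w - \<epsilon> * D n w)) \<partial>M)" for n
  define H where "H x j d = (\<integral>\<^sup>+ y. ennreal (g j (d + y)) \<partial>F x j)" for x j d
  have Hm [measurable]: "H x j \<in> borel_measurable borel" for x j
  proof -
    interpret F: prob_space "F x j" by fact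
    have "(\<lambda>(d, y). ennreal (g j (d + y))) \<in> borel_measurable (borel \<Otimes>\<^sub>M borel)" by measurable
    then have "(\<lambda>(d, y). ennreal (g j (d + y))) \<in> borel_measurable (borel \<Otimes>\<^sub>M F x j)"
      using measurable_cong_sets[OF sets_pair_measure_cong[OF refl sF, of borel] refl] by blast
    from F.borel_measurable_nn_integral_fst[OF this] show ?thesis by (simp add: H_def[abs_def])
  qed
  \<comment> \<open>The exponential continuation of \<open>g\<close> absorbs the change of the minimum: the reflected step is
    replaced by a free step with the old minimum as weight.\<close>
  have move: "exp (a * ?m (Suc n) w) * g j (D (Suc n) w) = exp (a * ?m n w) * g j (D n w + Y (Suc n) w)" for n j w
  proof (cases "D n w + Y (Suc n) w < 0")
    case True
    then have "?m (Suc n) w = ?m n w + (D n w + Y (Suc n) w)" "D (Suc n) w = 0"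
      by (auto simp: D_def running_min_Suc partial_sum_Suc)
    then show ?thesis using gneg[OF True] by (simp add: exp_add[symmetric] distrib_left)
  next
    case False
    then have "?m (Suc n) w = ?m n w" "D (Suc n) w = D n w + Y (Suc n) w"
      by (auto simp: D_def running_min_Suc partial_sum_Suc)
    then show ?thesis by simp
  qed
  have split: "I (Suc n) j w = (\<Sum>x\<in>UNIV. indicator {w \<in> space M. X n w = x \<and> X (Suc n) w = j} w)"
    if "w \<in> space M" for n j w
  proof -
    have "(\<Sum>x\<in>UNIV. indicator {w \<in> space M. X n w = x \<and> X (Suc n) w = j} w)
        = (\<Sum>x\<in>UNIV. I n x w * I (Suc n) j w)"
      by (intro sum.cong) (auto simp: I_def indicator_def)
    then show ?thesis using I1[OF that] by (simp add: sum_distrib_right[symmetric])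
  qed
  have trans: "(\<integral>\<^sup>+ w. ennreal (exp (a * ?m n w) * g j (D n w + Y (Suc n) w))
        * indicator {w \<in> space M. X n w = x \<and> X (Suc n) w = j} w \<partial>M)
      = (\<integral>\<^sup>+ w. ennreal (exp (a * ?m n w)) * (ennreal (P $ x $ j) * H x j (D n w)) * I n x w \<partial>M)" for n x j
  proof -
    \<comment> \<open>The pair \<open>r\<close> stands for the minimum and the sum at time \<open>n\<close>.\<close>
    define f where "f r y = ennreal (exp (a * fst r) * g j (snd r - fst r + y))" for r :: "real \<times> real" and y
    have f: "case_prod f \<in> borel_measurable ((borel \<Otimes>\<^sub>M borel) \<Otimes>\<^sub>M borel)"
      unfolding f_def by measurable
    have gF: "(\<lambda>y. ennreal (g j (d + y))) \<in> borel_measurable (F x j)" for d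
    proof -
      have "(\<lambda>y. ennreal (g j (d + y))) \<in> borel_measurable borel" by measurable
      then show ?thesis using measurable_cong_sets[OF sF refl] by blast
    qed
    have R: "(\<lambda>w. (?m n w, ?S n w)) \<in> measurable (past n) (borel \<Otimes>\<^sub>M borel)"
      using mp Sp by (rule measurable_Pair)
    have "(\<integral>\<^sup>+ w. f (?m n w, ?S n w) (Y (Suc n) w)
          * indicator {w \<in> space M. X n w = x \<and> X (Suc n) w = j} w \<partial>M)
      = ennreal (P $ x $ j) * (\<integral>\<^sup>+ w. (\<integral>\<^sup>+ y. f (?m n w, ?S n w) y \<partial>F x j)
          * indicator {w \<in> space M. X n w = x} w \<partial>M)"
      by (rule nn_integral_transition[OF pF sF P0 R f])
    also have "\<dots> = ennreal (P $ x $ j) * (\<integral>\<^sup>+ w. ennreal (exp (a * ?m n w)) * H x j (D n w) * I n x w \<partial>M)"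
    proof -
      have "(\<integral>\<^sup>+ y. f (?m n w, ?S n w) y \<partial>F x j) = ennreal (exp (a * ?m n w)) * H x j (D n w)" for w
        unfolding H_def f_def using gF by (simp add: D_def ennreal_mult g0 nn_integral_cmult)
      then show ?thesis by (simp add: I_def)
    qed
    also have "\<dots> = (\<integral>\<^sup>+ w. ennreal (P $ x $ j) * (ennreal (exp (a * ?m n w)) * H x j (D n w) * I n x w) \<partial>M)"
      by (rule nn_integral_cmult[symmetric]) measurable
    also have "\<dots> = (\<integral>\<^sup>+ w. ennreal (exp (a * ?m n w)) * (ennreal (P $ x $ j) * H x j (D n w)) * I n x w \<partial>M)"
      by (simp add: ac_simps)
    finally show ?thesis by (simp add: f_def D_def)
  qed
  have Ixj: "{w \<in> space M. X n w = x \<and> X (Suc n) w = j} \<in> sets M" for n x j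
  proof -
    have "{w \<in> space M. X n w = x \<and> X (Suc n) w = j} = {w \<in> space M. X n w = x} \<inter> {w \<in> space M. X (Suc n) w = j}" by auto
    then show ?thesis by simp
  qed
  note [measurable] = Y_measurable
  have VSuc: "V (Suc n) = (\<Sum>x\<in>UNIV. \<integral>\<^sup>+ w. ennreal (exp (a * ?m n w)) * (\<Sum>j\<in>UNIV. ennreal (P $ x $ j) * H x j (D n w)) * I n x w \<partial>M)" for n
  proof -
    have "V (Suc n) = (\<Sum>j\<in>UNIV. \<integral>\<^sup>+ w. (\<Sum>x\<in>UNIV. ennreal (exp (a * ?m n w) * g j (D n w + Y (Suc n) w))
        * indicator {w \<in> space M. X n w = x \<and> X (Suc n) w = j} w) \<partial>M)"
      unfolding V_def move
      by (intro sum.cong nn_integral_cong refl) (simp add: split sum_distrib_left)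
    also have "\<dots> = (\<Sum>j\<in>UNIV. \<Sum>x\<in>UNIV. \<integral>\<^sup>+ w. ennreal (exp (a * ?m n w) * g j (D n w + Y (Suc n) w))
        * indicator {w \<in> space M. X n w = x \<and> X (Suc n) w = j} w \<partial>M)"
      by (intro sum.cong nn_integral_sum refl) (use Ixj in measurable)
    also have "\<dots> = (\<Sum>x\<in>UNIV. \<Sum>j\<in>UNIV. \<integral>\<^sup>+ w. ennreal (exp (a * ?m n w)) * (ennreal (P $ x $ j) * H x j (D n w)) * I n x w \<partial>M)"
      unfolding trans by (rule sum.swap)
    also have "\<dots> = (\<Sum>x\<in>UNIV. \<integral>\<^sup>+ w. (\<Sum>j\<in>UNIV. ennreal (exp (a * ?m n w)) * (ennreal (P $ x $ j) * H x j (D n w)) * I n x w) \<partial>M)"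
      by (intro sum.cong nn_integral_sum[symmetric] refl) measurable
    finally show ?thesis by (simp add: sum_distrib_left sum_distrib_right)
  qed
  have Usplit: "ennreal c * U n = (\<Sum>x\<in>UNIV. \<integral>\<^sup>+ w. ennreal (exp (a * ?m n w)) * ennreal (c * exp (- \<epsilon> * D n w)) * I n x w \<partial>M)" for n
  proof -
    have e: "ennreal (exp (a * ?m n w)) * ennreal (c * exp (- \<epsilon> * D n w)) = ennreal c * ennreal (exp (a * ?m n w - \<epsilon> * D n w))" for w
      using c by (simp add: ennreal_mult[symmetric] exp_diff exp_minus field_simps)
    have "(\<Sum>x\<in>UNIV. \<integral>\<^sup>+ w. ennreal (exp (a * ?m n w)) * ennreal (c * exp (- \<epsilon> * D n w)) * I n x w \<partial>M)
        = (\<integral>\<^sup>+ w. (\<Sum>x\<in>UNIV. ennreal c * ennreal (exp (a * ?m n w - \<epsilon> * D n w)) * I n x w) \<partial>M)"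
      unfolding e by (intro nn_integral_sum[symmetric]) measurable
    also have "\<dots> = (\<integral>\<^sup>+ w. ennreal c * ennreal (exp (a * ?m n w - \<epsilon> * D n w)) \<partial>M)"
      by (intro nn_integral_cong) (simp add: sum_distrib_left[symmetric] I1)
    also have "\<dots> = ennreal c * U n"
      unfolding U_def by (rule nn_integral_cmult) measurable
    finally show ?thesis ..
  qed
  have decr: "V (Suc n) + ennreal c * U n \<le> V n" for n
  proof -
    have "V (Suc n) + ennreal c * U n = (\<Sum>x\<in>UNIV. \<integral>\<^sup>+ w.
        ennreal (exp (a * ?m n w)) * (\<Sum>j\<in>UNIV. ennreal (P $ x $ j) * H x j (D n w)) * I n x w
        + ennreal (exp (a * ?m n w)) * ennreal (c * exp (- \<epsilon> * D n w)) * I n x w \<partial>M)"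
      unfolding VSuc Usplit sum.distrib[symmetric]
      by (intro sum.cong nn_integral_add[symmetric] refl) measurable
    also have "\<dots> \<le> V n"
      unfolding V_def
    proof (intro sum_mono nn_integral_mono)
      fix x w
      have "(\<Sum>j\<in>UNIV. ennreal (P $ x $ j) * H x j (D n w)) + ennreal (c * exp (- \<epsilon> * D n w)) \<le> ennreal (g x (D n w))"
        unfolding H_def by (rule gstep[OF D0])
      then have "ennreal (exp (a * ?m n w)) * ((\<Sum>j\<in>UNIV. ennreal (P $ x $ j) * H x j (D n w)) + ennreal (c * exp (- \<epsilon> * D n w))) * I n x w
          \<le> ennreal (exp (a * ?m n w)) * ennreal (g x (D n w)) * I n x w"
        by (intro mult_right_mono mult_left_mono) auto
      then show "ennreal (exp (a * ?m n w)) * (\<Sum>j\<in>UNIV. ennreal (P $ x $ j) * H x j (D n w)) * I n x w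
        + ennreal (exp (a * ?m n w)) * ennreal (c * exp (- \<epsilon> * D n w)) * I n x w
        \<le> ennreal (exp (a * ?m n w) * g x (D n w)) * I n x w"
        by (simp add: ennreal_mult g0 distrib_left distrib_right)
    qed
    finally show ?thesis .
  qed
  have tel: "(\<Sum>k<n. ennreal c * U k) + V n \<le> V 0" for n
  proof (induction n)
    case (Suc n)
    have "(\<Sum>k<Suc n. ennreal c * U k) + V (Suc n) = (\<Sum>k<n. ennreal c * U k) + (V (Suc n) + ennreal c * U n)"
      by (simp add: ac_simps)
    also have "\<dots> \<le> (\<Sum>k<n. ennreal c * U k) + V n" by (intro add_left_mono decr)
    finally show ?case using Suc.IH by (rule order_trans)
  qed simp
  have "(\<Sum>k<n. ennreal c * U k) \<le> V 0" for n
    using tel[of n] by (meson le_add_same_cancel1 order_trans zero_le add_increasing2 order_refl)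
  then have "(\<Sum>k. ennreal c * U k) \<le> V 0"
    unfolding suminf_eq_SUP by (rule SUP_least)
  then have cU: "ennreal c * (\<Sum>k. U k) \<le> V 0" by (simp add: ennreal_suminf_cmult)
  have "V 0 < \<infinity>"
  proof -
    have "(\<integral>\<^sup>+ w. ennreal (exp (a * ?m 0 w) * g x (D 0 w)) * I 0 x w \<partial>M) \<le> (\<integral>\<^sup>+ w. ennreal (g x 0) \<partial>M)" for x
      by (intro nn_integral_mono) (auto simp: D_def running_min_0 partial_sum_0 I_def indicator_def)
    then have "(\<integral>\<^sup>+ w. ennreal (exp (a * ?m 0 w) * g x (D 0 w)) * I 0 x w \<partial>M) \<le> ennreal (g x 0)" for x
      by (simp add: emeasure_space_1)
    then have "V 0 \<le> (\<Sum>x\<in>UNIV. ennreal (g x 0))"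
      unfolding V_def by (rule sum_mono)
    also have "\<dots> < \<infinity>" using g0 by (simp add: sum_ennreal)
    finally show ?thesis .
  qed
  with cU have "ennreal c * (\<Sum>k. U k) < \<infinity>" by (rule le_less_trans)
  then have "(\<Sum>k. U k) < \<infinity>" using c by (auto simp: ennreal_mult_less_top)
  then show ?thesis by (simp add: U_def D_def)
qed

end

lemma exponential_moments_of_H1:
  assumes "hyp_H1 F" and sF: "\<And>i j. sets (F i j) = sets borel"
  shows "\<exists>\<alpha>>0. (\<forall>s i j. \<bar>s\<bar> \<le> \<alpha> \<longrightarrow> integrable (F i j) (\<lambda>t. exp (s * t)))
     \<and> (\<forall>i j. integrable (F i j) (\<lambda>t. t))"
proof -
  obtain \<alpha> where \<alpha>: "0 < \<alpha>" and
    i: "\<And>l i j. \<bar>Re l\<bar> \<le> \<alpha> \<Longrightarrow> integrable (F i j) (\<lambda>t. exp (l * complex_of_real t))"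
    using assms(1) unfolding hyp_H1_def by blast
  have e: "integrable (F i j) (\<lambda>t. exp (s * t))" if "\<bar>s\<bar> \<le> \<alpha>" for s i j
    using integrable_norm[OF i[of "complex_of_real s" i j]] that by simp
  have "integrable (F i j) (\<lambda>t. t)" for i j
  proof (rule Bochner_Integration.integrable_bound)
    show "integrable (F i j) (\<lambda>t. (exp (\<alpha> * t) + exp (- \<alpha> * t)) / \<alpha>)"
      using e[of \<alpha> i j] e[of "- \<alpha>" i j] \<alpha> by simp
    show "(\<lambda>t. t) \<in> borel_measurable (F i j)"
      using measurable_cong_sets[OF sF refl] measurable_ident by (metis (no_types) measurable_ident_sets sF)
    have "\<bar>t\<bar> \<le> (exp (\<alpha> * t) + exp (- \<alpha> * t)) / \<alpha>" for t
    proof -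
      define x where "x = \<alpha> * t"
      have "\<bar>x\<bar> \<le> exp x + exp (- x)"
        using exp_ge_add_one_self[of x] exp_ge_add_one_self[of "- x"] exp_gt_zero[of x] exp_gt_zero[of "- x"]
        by linarith
      then have "\<alpha> * \<bar>t\<bar> \<le> exp (\<alpha> * t) + exp (- \<alpha> * t)"
        using \<alpha> by (simp add: x_def abs_mult)
      then show ?thesis using \<alpha> by (simp add: field_simps)
    qed
    then show "AE t in F i j. norm t \<le> norm ((exp (\<alpha> * t) + exp (- \<alpha> * t)) / \<alpha>)"
      by (intro AE_I2) (metis abs_ge_self order_trans real_norm_def)
  qed
  then show ?thesis using e \<alpha> by blast
qed

theorem theorem1p3:
  fixes P :: "real^'e^('e::finite)"
    and \<nu> :: "real^'e"
    and F :: "'e \<Rightarrow> 'e \<Rightarrow> real measure"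
    and \<PP> :: "'e \<Rightarrow> 'w measure"
    and Y :: "nat \<Rightarrow> 'w \<Rightarrow> real"
    and X :: "nat \<Rightarrow> 'w \<Rightarrow> 'e"
  assumes "transition_matrix P"
    and "irreducible_matrix P"
    and "aperiodic_matrix P"
    and "invariant_probability P \<nu>"
    and "\<And>i j. prob_space (F i j)"
    and "\<And>i j. sets (F i j) = sets borel"
    and "\<And>i. markov_additive_chain (\<PP> i) P F Y X i"
    and "hyp_H1 F"
    and "hyp_H2 \<PP> Y X"
    and "hyp_H3 P \<nu> F"
  shows "\<exists>lam0>0. \<forall>eps lam :: real. 0 < eps \<and> eps < lam \<and> lam \<le> lam0 \<longrightarrow>
    (\<forall>i j. (\<Sum>n. \<integral>\<^sup>+ w. ennreal (exp (lam * running_min Y n w - eps * partial_sum Y n w))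
                       * indicator {w \<in> space (\<PP> i). X n w = j} w \<partial>\<PP> i) < \<infinity>)"
proof -
  note pF = assms(5) and sF = assms(6)
  have P0: "0 \<le> P $ i $ j" for i j using assms(1) by (simp add: transition_matrix_def)
  obtain \<alpha> where \<alpha>: "0 < \<alpha>" and e: "\<And>s i j. \<bar>s\<bar> \<le> \<alpha> \<Longrightarrow> integrable (F i j) (\<lambda>t. exp (s * t))"
    and t: "\<And>i j. integrable (F i j) (\<lambda>t. t)"
    using exponential_moments_of_H1[OF assms(8) sF] by blast
  obtain n0 i0 j0 where ac: "has_ac_component (sum_law_on (\<PP> i0) Y X n0 j0)"
    using assms(9) unfolding hyp_H2_def by blast
  have nondeg: "\<exists>x j. 0 < P $ x $ j \<and> \<not> (AE t in F x j. t = h x - h j)" for h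
    by (rule markov_additive_chain.increments_not_coboundary[OF assms(7) pF sF P0 ac])
  have "(\<Sum>n. \<integral>\<^sup>+ w. ennreal (exp (lam * running_min Y n w - eps * partial_sum Y n w))
                       * indicator {w \<in> space (\<PP> i). X n w = j} w \<partial>\<PP> i) < \<infinity>"
    if par: "0 < eps" "eps < lam" "lam \<le> \<alpha>" for eps lam i j
  proof -
    obtain \<phi> where \<phi>: "\<And>i. 0 < \<phi> $ i" "\<And>i. \<phi> $ i < (tilted_matrix P F (- eps) *v \<phi>) $ i"
      using tilted_matrix_strictly_subharmonic[OF assms(1,2,4) pF t e assms(10) nondeg, of "- eps"] par
      by auto
    obtain g c where gc: "0 < c" "\<And>x. g x \<in> borel_measurable borel" "\<And>x u. 0 \<le> g x u"
      "\<And>x u. u < 0 \<Longrightarrow> g x u = exp ((lam - eps) * u) * g x 0"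
      "\<And>x d. 0 \<le> d \<Longrightarrow> (\<Sum>j\<in>UNIV. ennreal (P $ x $ j) * (\<integral>\<^sup>+ y. ennreal (g j (d + y)) \<partial>F x j))
          + ennreal (c * exp (- eps * d)) \<le> ennreal (g x d)"
    proof -
      have "\<bar>- eps\<bar> \<le> \<alpha>" "\<bar>- \<alpha>\<bar> \<le> \<alpha>" "eps < \<alpha>" "0 < lam - eps" using par by auto
      from lyapunov_function_exists[of P F eps \<alpha> "lam - eps" \<phi>,
          OF assms(1) pF e[OF this(1)] e[OF this(2)] par(1) this(3,4) \<phi>]
      show ?thesis using that by blast
    qed
    have "(\<Sum>n. \<integral>\<^sup>+ w. ennreal (exp (lam * running_min Y n w - eps * partial_sum Y n w))
            * indicator {w \<in> space (\<PP> i). X n w = j} w \<partial>\<PP> i)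
        \<le> (\<Sum>n. \<integral>\<^sup>+ w. ennreal (exp ((lam - eps) * running_min Y n w
            - eps * (partial_sum Y n w - running_min Y n w))) \<partial>\<PP> i)"
      by (intro suminf_le summableI nn_integral_mono) (auto simp: indicator_def algebra_simps)
    also have "\<dots> < \<infinity>"
      by (rule markov_additive_chain.weighted_occupation_finite[OF assms(7) pF sF P0 gc])
    finally show ?thesis .
  qed
  then show ?thesis using \<alpha> by blast
qed

end
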